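(* For every finite set $\Phi$ of formulas of infinite-valued Łukasiewicz propositional logic, the Lindenbaum algebra $\mathsf{LIND}(\Phi)$ is strongly semisimple.
   Context: For a set $\Phi\subseteq\mathsf{FORM}_n$ of formulas in the variables $X_1,\dots,X_n$, $\mathsf{LIND}(\Phi)$ is the MV-algebra $\mathsf{FORM}_n$ modulo the equivalence $\phi\equiv_\Phi\psi$ iff $\Phi\vdash\phi\leftrightarrow\psi$ (derivability from $\Phi$ via the Łukasiewicz axioms and Modus Ponens). An MV-algebra is semisimple if the intersection of its maximal ideals is $\{0\}$; it is strongly semisimple if its quotient by every principal ideal is semisimple. *)

theory Defs
  imports "HOL-Algebra.Congruence"
begin

record 'a mv_struct = "'a partial_object" +
  mv_plus :: "['a, 'a] \<Rightarrow> 'a" (infixl "\<oplus>\<index>" 65)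
  mv_neg  :: "'a \<Rightarrow> 'a" ("\<sim>\<index> _" [81] 80)
  mv_zero :: 'a ("\<zero>\<index>")

locale mv_algebra =
  fixes A (structure)
  assumes plus_closed: "\<lbrakk>x \<in> carrier A; y \<in> carrier A\<rbrakk> \<Longrightarrow> x \<oplus> y \<in> carrier A"
    and neg_closed: "x \<in> carrier A \<Longrightarrow> \<sim> x \<in> carrier A"
    and zero_closed: "\<zero> \<in> carrier A"
    and plus_assoc: "\<lbrakk>x \<in> carrier A; y \<in> carrier A; z \<in> carrier A\<rbrakk> \<Longrightarrow>
      x \<oplus> (y \<oplus> z) = (x \<oplus> y) \<oplus> z"
    and plus_comm: "\<lbrakk>x \<in> carrier A; y \<in> carrier A\<rbrakk> \<Longrightarrow> x \<oplus> y = y \<oplus> x"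
    and plus_zero: "x \<in> carrier A \<Longrightarrow> x \<oplus> \<zero> = x"
    and neg_neg: "x \<in> carrier A \<Longrightarrow> \<sim> (\<sim> x) = x"
    and plus_one: "x \<in> carrier A \<Longrightarrow> x \<oplus> \<sim> \<zero> = \<sim> \<zero>"
    and luk: "\<lbrakk>x \<in> carrier A; y \<in> carrier A\<rbrakk> \<Longrightarrow>
      \<sim> (\<sim> x \<oplus> y) \<oplus> y = \<sim> (\<sim> y \<oplus> x) \<oplus> x"

definition mv_minus :: "('a, 'b) mv_struct_scheme \<Rightarrow> 'a \<Rightarrow> 'a \<Rightarrow> 'a" where
  "mv_minus A x y = \<sim>\<^bsub>A\<^esub> (\<sim>\<^bsub>A\<^esub> x \<oplus>\<^bsub>A\<^esub> y)"

definition mv_le :: "('a, 'b) mv_struct_scheme \<Rightarrow> 'a \<Rightarrow> 'a \<Rightarrow> bool" where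
  "mv_le A x y \<longleftrightarrow> \<sim>\<^bsub>A\<^esub> x \<oplus>\<^bsub>A\<^esub> y = \<sim>\<^bsub>A\<^esub> \<zero>\<^bsub>A\<^esub>"

definition mv_dist :: "('a, 'b) mv_struct_scheme \<Rightarrow> 'a \<Rightarrow> 'a \<Rightarrow> 'a" where
  "mv_dist A x y = mv_minus A x y \<oplus>\<^bsub>A\<^esub> mv_minus A y x"

definition mv_ideal :: "('a, 'b) mv_struct_scheme \<Rightarrow> 'a set \<Rightarrow> bool" where
  "mv_ideal A I \<longleftrightarrow> I \<subseteq> carrier A \<and> \<zero>\<^bsub>A\<^esub> \<in> I \<and>
     (\<forall>x\<in>I. \<forall>y\<in>I. x \<oplus>\<^bsub>A\<^esub> y \<in> I) \<and>
     (\<forall>x\<in>I. \<forall>y\<in>carrier A. mv_le A y x \<longrightarrow> y \<in> I)"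

definition mv_maximal_ideal :: "('a, 'b) mv_struct_scheme \<Rightarrow> 'a set \<Rightarrow> bool" where
  "mv_maximal_ideal A M \<longleftrightarrow> mv_ideal A M \<and> M \<noteq> carrier A \<and>
     (\<forall>J. mv_ideal A J \<and> M \<subseteq> J \<longrightarrow> J = M \<or> J = carrier A)"

definition mv_ideal_gen :: "('a, 'b) mv_struct_scheme \<Rightarrow> 'a \<Rightarrow> 'a set" where
  "mv_ideal_gen A a = \<Inter> {I. mv_ideal A I \<and> a \<in> I}"

definition mv_principal_ideal :: "('a, 'b) mv_struct_scheme \<Rightarrow> 'a set \<Rightarrow> bool" where
  "mv_principal_ideal A I \<longleftrightarrow> (\<exists>a\<in>carrier A. I = mv_ideal_gen A a)"

definition mv_cong :: "('a, 'b) mv_struct_scheme \<Rightarrow> 'a set \<Rightarrow> ('a \<times> 'a) set" where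
  "mv_cong A I = {(x, y). x \<in> carrier A \<and> y \<in> carrier A \<and> mv_dist A x y \<in> I}"

definition mv_quotient :: "('a, 'b) mv_struct_scheme \<Rightarrow> 'a set \<Rightarrow> 'a set mv_struct" where
  "mv_quotient A I =
    \<lparr> carrier = carrier A // mv_cong A I,
      mv_plus = (\<lambda>X Y. \<Union>x\<in>X. \<Union>y\<in>Y. mv_cong A I `` {x \<oplus>\<^bsub>A\<^esub> y}),
      mv_neg = (\<lambda>X. \<Union>x\<in>X. mv_cong A I `` {\<sim>\<^bsub>A\<^esub> x}),
      mv_zero = mv_cong A I `` {\<zero>\<^bsub>A\<^esub>} \<rparr>"

text \<open>The intersection is taken inside the carrier, so that the empty intersection is
  the whole algebra and the one-element algebra (which has no maximal ideal) is semisimple.\<close>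

definition mv_semisimple :: "('a, 'b) mv_struct_scheme \<Rightarrow> bool" where
  "mv_semisimple A \<longleftrightarrow> mv_algebra A \<and>
     carrier A \<inter> \<Inter> {M. mv_maximal_ideal A M} = {\<zero>\<^bsub>A\<^esub>}"

definition mv_strongly_semisimple :: "('a, 'b) mv_struct_scheme \<Rightarrow> bool" where
  "mv_strongly_semisimple A \<longleftrightarrow> mv_algebra A \<and>
     (\<forall>I. mv_principal_ideal A I \<longrightarrow> mv_semisimple (mv_quotient A I))"

datatype form = Var nat | Neg form | Imp form form

primrec form_vars :: "form \<Rightarrow> nat set" where
  "form_vars (Var i) = {i}"
| "form_vars (Neg p) = form_vars p"
| "form_vars (Imp p q) = form_vars p \<union> form_vars q"

definition FORM :: "nat \<Rightarrow> form set" where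
  "FORM n = {p. form_vars p \<subseteq> {1..n}}"

definition Oplus :: "form \<Rightarrow> form \<Rightarrow> form" where
  "Oplus p q = Imp (Neg p) q"

definition Odot :: "form \<Rightarrow> form \<Rightarrow> form" where
  "Odot p q = Neg (Imp p (Neg q))"

definition Iff :: "form \<Rightarrow> form \<Rightarrow> form" where
  "Iff p q = Odot (Imp p q) (Imp q p)"

inductive luk_derives :: "form set \<Rightarrow> form \<Rightarrow> bool" for \<Phi> where
  hyp: "p \<in> \<Phi> \<Longrightarrow> luk_derives \<Phi> p"
| ax1: "luk_derives \<Phi> (Imp p (Imp q p))"
| ax2: "luk_derives \<Phi> (Imp (Imp p q) (Imp (Imp q r) (Imp p r)))"
| ax3: "luk_derives \<Phi> (Imp (Imp (Imp p q) q) (Imp (Imp q p) p))"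
| ax4: "luk_derives \<Phi> (Imp (Imp (Neg p) (Neg q)) (Imp q p))"
| mp: "luk_derives \<Phi> p \<Longrightarrow> luk_derives \<Phi> (Imp p q) \<Longrightarrow> luk_derives \<Phi> q"

definition lind_equiv :: "nat \<Rightarrow> form set \<Rightarrow> (form \<times> form) set" where
  "lind_equiv n \<Phi> = {(p, q). p \<in> FORM n \<and> q \<in> FORM n \<and> luk_derives \<Phi> (Iff p q)}"

text \<open>There is no constant among the connectives, so zero is the class of a refutable
  formula; this needs at least one variable, that is, \<open>n \<ge> 1\<close>
  (for \<open>n = 0\<close> there are no formulas at all).\<close>

definition LIND :: "nat \<Rightarrow> form set \<Rightarrow> form set mv_struct" where
  "LIND n \<Phi> =
    \<lparr> carrier = FORM n // lind_equiv n \<Phi>,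
      mv_plus = (\<lambda>P Q. \<Union>p\<in>P. \<Union>q\<in>Q. lind_equiv n \<Phi> `` {Oplus p q}),
      mv_neg = (\<lambda>P. \<Union>p\<in>P. lind_equiv n \<Phi> `` {Neg p}),
      mv_zero = lind_equiv n \<Phi> `` {Neg (Imp (Var 1) (Var 1))} \<rparr>"

end

theory Submission
  imports Defs "HOL-Algebra.FiniteProduct" Complex_Main
begin

text \<open>
  The point is the theorem of Hay and Wojcicki: a formula that is not derivable from a finite
  set of formulas is already refuted by a valuation in the real unit interval.
  If an element \<open>b\<close> of an MV-algebra is nonzero, some prime ideal avoids it, and the quotient is
  an MV-chain. Chang's construction embeds the chain into a totally ordered abelian group \<open>G\<close>.
  Only the signs of finitely many integer combinations of elements of \<open>G\<close> matter for the
  evaluation of finitely many formulas, and Fourier--Motzkin elimination replaces \<open>G\<close> by the reals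
  without changing them. For a principal ideal generated by the class of \<open>a\<close>, apply this to the
  finite set \<open>\<Phi> \<union> {\<not> a}\<close>: the resulting valuation is a homomorphism of the quotient into the unit
  interval that does not vanish at \<open>b\<close>, and its kernel is a maximal ideal.
\<close>

section \<open>Total preorders on integer vectors\<close>

text \<open>The chain obtained from a prime ideal may contain infinitesimals, so it need not embed
  into the unit interval, and a real-valued homomorphism of the whole chain could send an element
  below one to one. Separation can therefore only be kept on a finite part of the chain, and this is
  where finiteness of \<Phi> enters. The valuation found there respects the values of finitely many
  formulas; it is then soundness of the calculus, not the chain, that turns it into a homomorphism
  on the whole Lindenbaum algebra. A principal ideal costs just one further formula: the kernel of
  that homomorphism is an ideal, so it contains the whole ideal as soon as it contains the
  generator. Maximality of the kernel comes from the Archimedean property of the reals.\<close>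

lemma separating_point:
  fixes t :: "'a \<Rightarrow> real"
  assumes "finite H" and cover: "\<And>h. h \<in> H \<Longrightarrow> L h \<or> U h"
    and le: "\<And>g h. g \<in> H \<Longrightarrow> h \<in> H \<Longrightarrow> L g \<Longrightarrow> U h \<Longrightarrow> t g \<le> t h"
    and less: "\<And>g h. g \<in> H \<Longrightarrow> h \<in> H \<Longrightarrow> L g \<Longrightarrow> U h \<Longrightarrow> \<not> U g \<or> \<not> L h \<Longrightarrow> t g < t h"
  shows "\<exists>c. \<forall>h\<in>H. (L h \<longleftrightarrow> t h \<le> c) \<and> (U h \<longleftrightarrow> c \<le> t h)"
\<comment> \<open>Each \<open>h\<close> prescribes on which side of \<open>t h\<close> the point
  \<open>c\<close> lies. \<open>L h\<close> together with \<open>U h\<close> forces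
  \<open>c = t h\<close>, and pairwise consistency then settles all other constraints.\<close>
proof (cases "\<exists>h\<in>H. L h \<and> U h")
  case True
  then obtain h0 where "h0 \<in> H" "L h0" "U h0" by blast
  then show ?thesis
    using cover le less by (intro exI[of _ "t h0"]) (meson not_le)
next
  case False
  \<comment> \<open>Every constraint is now strict, so \<open>c\<close> has to lie above the finite
    set \<open>lo\<close> and below the finite set \<open>hi\<close>.\<close>
  define lo where "lo = t ` {h \<in> H. L h}"
  define hi where "hi = t ` {h \<in> H. U h}"
  have fin: "finite lo" "finite hi" using \<open>finite H\<close> by (auto simp: lo_def hi_def)
  have "\<exists>c. (\<forall>a\<in>lo. a < c) \<and> (\<forall>b\<in>hi. c < b)"
  proof -
    have *: "a < b" if "a \<in> lo" "b \<in> hi" for a b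
      using that less False by (auto simp: lo_def hi_def)
    show ?thesis
    proof (cases "lo = {}")
      case True
      show ?thesis
      proof (cases "hi = {}")
        case False
        show ?thesis using True Min_le[OF fin(2)] by (intro exI[of _ "Min hi - 1"]) force
      qed (use True in auto)
    next
      case False
      show ?thesis
      proof (cases "hi = {}")
        case True
        then show ?thesis using Max_ge[OF fin(1)] by (intro exI[of _ "Max lo + 1"]) force
      next
        case False
        have "Max lo < Min hi" using * fin \<open>lo \<noteq> {}\<close> False by simp
        then obtain c where "Max lo < c" "c < Min hi" using dense by blast
        then show ?thesis using fin \<open>lo \<noteq> {}\<close> False by (intro exI[of _ c]) auto
      qed
    qed
  qed
  then obtain c where c: "\<And>a. a \<in> lo \<Longrightarrow> a < c" "\<And>b. b \<in> hi \<Longrightarrow> c < b" by blast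
  have "(L h \<longleftrightarrow> t h \<le> c) \<and> (U h \<longleftrightarrow> c \<le> t h)" if "h \<in> H" for h
    using cover[OF that] False that c(1)[of "t h"] c(2)[of "t h"] by (force simp: lo_def hi_def)
  then show ?thesis by blast
qed

text \<open>\<open>Q f\<close> reads as nonnegativity of \<open>f\<close> in a translation-invariant
  total preorder on integer vectors, and \<open>\<not> Q (\<lambda>i. - f i)\<close> as strict
  positivity. It is a preorder because the evaluation of vectors in a group may have a
  kernel.\<close>

locale total_cone =
  fixes Q :: "('i \<Rightarrow> int) \<Rightarrow> bool"
  assumes add: "Q f \<Longrightarrow> Q g \<Longrightarrow> Q (\<lambda>i. f i + g i)"
    and total: "Q f \<or> Q (\<lambda>i. - f i)"
begin

lemma zero: "Q (\<lambda>i. 0)"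
  using total[of "\<lambda>i. 0"] by simp

lemma scale:
  assumes "Q f" "0 \<le> c" shows "Q (\<lambda>i. c * f i)"
proof -
  have "Q (\<lambda>i. int k * f i)" for k
  proof (induction k)
    case (Suc k)
    then show ?case using add[OF \<open>Q f\<close> Suc] by (simp add: algebra_simps)
  qed (simp add: zero)
  from this[of "nat c"] show ?thesis using assms by simp
qed

lemma add_strict:
  assumes "Q f" "\<not> Q (\<lambda>i. - g i)" shows "\<not> Q (\<lambda>i. - (f i + g i))"
  using add[OF \<open>Q f\<close>, of "\<lambda>i. - (f i + g i)"] assms(2) by auto

text \<open>If \<open>c * f\<close> were nonpositive, adding the nonnegative
  \<open>(c - 1) * f\<close> would make \<open>- f\<close> nonnegative.\<close>

lemma scale_strict:
  assumes "\<not> Q (\<lambda>i. - f i)" "0 < c" shows "\<not> Q (\<lambda>i. - (c * f i))"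
proof
  assume *: "Q (\<lambda>i. - (c * f i))"
  have "Q f" using assms total by blast
  then have "Q (\<lambda>i. (c - 1) * f i)" using scale assms by simp
  from add[OF * this] show False using assms by (simp add: algebra_simps)
qed

text \<open>Fourier--Motzkin elimination: \<open>f\<^sub>j g - g\<^sub>j f\<close> does not involve the coordinate \<open>j\<close>.\<close>

lemma represented_by_functional:
  assumes "finite K" "finite F" "\<And>f i. f \<in> F \<Longrightarrow> i \<notin> K \<Longrightarrow> f i = 0"
  shows "\<exists>x :: 'i \<Rightarrow> real. \<forall>f\<in>F. Q f \<longleftrightarrow> 0 \<le> (\<Sum>i\<in>K. of_int (f i) * x i)"
  using assms
proof (induction K arbitrary: F rule: finite_induct)
  case empty
  then have "f = (\<lambda>i. 0)" if "f \<in> F" for f using that by auto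
  then show ?case using zero by auto
next
  case (insert j K)
  \<comment> \<open>Closing \<open>F\<close> under negation lets every vector with a nonzero
    coordinate \<open>j\<close> be replaced by one whose coordinate is positive.\<close>
  define F0 where "F0 = F \<union> (\<lambda>f i. - f i) ` F"
  have F0: "finite F0" "\<And>f i. f \<in> F0 \<Longrightarrow> i \<notin> insert j K \<Longrightarrow> f i = 0" "F \<subseteq> F0"
    and neg: "\<And>f. f \<in> F0 \<Longrightarrow> (\<lambda>i. - f i) \<in> F0"
    using insert.prems by (auto simp: F0_def image_iff)
  define elim where "elim f g = (\<lambda>i. f j * g i - g j * f i)" for f g :: "'i \<Rightarrow> int"
  \<comment> \<open>The induction hypothesis realises the order on vectors free of \<open>j\<close>;
    the eliminants of pairs record how the bounds for the new coordinate compare.\<close>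
  define F' where "F' = {f \<in> F0. f j = 0} \<union> (\<lambda>(f, g). elim f g) ` (F0 \<times> F0)"
  have "finite F'" "\<And>f i. f \<in> F' \<Longrightarrow> i \<notin> K \<Longrightarrow> f i = 0"
    using F0 by (auto simp: F'_def elim_def)
      (metis insert_iff mult.commute mult_zero_right diff_self F0(2))+
  then obtain x :: "'i \<Rightarrow> real" where x: "\<And>f. f \<in> F' \<Longrightarrow> Q f \<longleftrightarrow> 0 \<le> (\<Sum>i\<in>K. of_int (f i) * x i)"
    using insert.IH[of F'] by blast
  define D where "D f = (\<Sum>i\<in>K. of_int (f i) * x i)" for f :: "'i \<Rightarrow> int"
  have D_neg: "D (\<lambda>i. - f i) = - D f" for f by (simp add: D_def sum_negf)
  have D_elim: "D (elim f g) = of_int (f j) * D g - of_int (g j) * D f" for f g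
    by (simp add: D_def elim_def sum_distrib_left algebra_simps sum_subtractf)
  \<comment> \<open>\<open>t f\<close> is the value of the new coordinate at which the functional
    vanishes on \<open>f\<close>; for \<open>f\<close> in \<open>H\<close>, nonnegativity says that
    this coordinate is at least \<open>t f\<close>.\<close>
  define t where "t f = - D f / of_int (f j)" for f :: "'i \<Rightarrow> int"
  define H where "H = {f \<in> F0. 0 < f j}"
  have t_diff: "D (elim f g) = of_int (f j * g j) * (t f - t g)" if "f \<in> H" "g \<in> H" for f g
    using that by (simp add: D_elim t_def H_def field_simps)
  have Q_elim: "Q (elim f g) \<longleftrightarrow> t g \<le> t f" if "f \<in> H" "g \<in> H" for f g
  proof -
    have "elim f g \<in> F'" using that by (auto simp: F'_def H_def)
    then have "Q (elim f g) \<longleftrightarrow> 0 \<le> of_int (f j * g j) * (t f - t g)"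
      unfolding t_diff[OF that, symmetric] by (simp add: x D_def)
    moreover have "(0 :: real) < of_int (f j * g j)" using that by (simp add: H_def)
    ultimately show ?thesis by (simp only: zero_le_mult_iff) auto
  qed
  have "\<exists>c. \<forall>h\<in>H. (Q h \<longleftrightarrow> t h \<le> c) \<and> (Q (\<lambda>i. - h i) \<longleftrightarrow> c \<le> t h)"
  proof (rule separating_point)
    fix g h assume gh: "g \<in> H" "h \<in> H" "Q g" "Q (\<lambda>i. - h i)"
    then have pos: "0 < g j" "0 < h j" by (auto simp: H_def)
    \<comment> \<open>The eliminant is a combination of \<open>g\<close> and \<open>- h\<close> with
      positive weights, so it inherits their signs.\<close>
    have eq: "elim h g = (\<lambda>i. h j * g i + g j * - h i)" by (simp add: elim_def)
    have "Q (elim h g)"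
      unfolding eq using add[OF scale[OF gh(3), of "h j"] scale[OF gh(4), of "g j"]] pos by simp
    then show "t g \<le> t h" using Q_elim gh by blast
    assume "\<not> Q (\<lambda>i. - g i) \<or> \<not> Q h"
    then have "\<not> Q (elim g h)"
    proof
      assume "\<not> Q (\<lambda>i. - g i)"
      from add_strict[OF scale[OF gh(4), of "g j"] scale_strict[OF this pos(2)]] pos
      show ?thesis by (simp add: elim_def algebra_simps)
    next
      assume "\<not> Q h"
      then have "\<not> Q (\<lambda>i. - (- h i))" by simp
      from add_strict[OF scale[OF gh(3), of "h j"] scale_strict[OF this pos(1)]] pos
      show ?thesis by (simp add: elim_def algebra_simps)
    qed
    then show "t g < t h" using Q_elim gh by simp
  qed (use F0 total in \<open>auto simp: H_def\<close>)
  then obtain c where c: "\<And>h. h \<in> H \<Longrightarrow> Q h \<longleftrightarrow> t h \<le> c"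
    "\<And>h. h \<in> H \<Longrightarrow> Q (\<lambda>i. - h i) \<longleftrightarrow> c \<le> t h" by blast
  have "Q f \<longleftrightarrow> 0 \<le> of_int (f j) * c + D f" if f: "f \<in> F0" for f
  proof (cases "f j" "0 :: int" rule: linorder_cases)
    case greater
    then show ?thesis using c(1)[of f] f by (simp add: H_def t_def field_simps) linarith
  next
    case equal
    then show ?thesis using x[of f] f by (simp add: F'_def D_def)
  next
    case less
    then have "(\<lambda>i. - f i) \<in> H" using neg[OF f] by (simp add: H_def)
    then show ?thesis using c(2)[of "\<lambda>i. - f i"] less by (simp add: t_def D_neg field_simps) linarith
  qed
  moreover have "(\<Sum>i\<in>insert j K. of_int (f i) * (x(j := c)) i) = of_int (f j) * c + D f" for f
  proof -
    have "(\<Sum>i\<in>K. of_int (f i) * (x(j := c)) i) = D f"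
      unfolding D_def using insert.hyps by (intro sum.cong) auto
    then show ?thesis using insert.hyps by simp
  qed
  ultimately show ?case using F0(3) by (intro exI[of _ "x(j := c)"]) (metis subsetD)
qed

end

section \<open>Signs of integer combinations in an ordered abelian group\<close>

context comm_group
begin

text \<open>Evaluating exponent vectors at \<open>E\<close> is a homomorphism, so \<open>N\<close>
  pulls back to a total cone. Comparing two-term products is enough later: with zero and the unit
  among the \<open>E i\<close>, such comparisons express negation, truncated addition and all
  bounds.\<close>

lemma finite_order_representation:
  fixes E :: "'i \<Rightarrow> 'a"
  assumes N_mult: "\<And>a b. a \<in> carrier G \<Longrightarrow> b \<in> carrier G \<Longrightarrow> N a \<Longrightarrow> N b \<Longrightarrow> N (a \<otimes> b)"
    and N_total: "\<And>a. a \<in> carrier G \<Longrightarrow> N a \<or> N (inv a)"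
    and J: "finite J" "E \<in> J \<rightarrow> carrier G"
  shows "\<exists>x :: 'i \<Rightarrow> real. \<forall>i\<in>J. \<forall>j\<in>J. \<forall>k\<in>J. \<forall>l\<in>J.
    N ((E i \<otimes> E j) \<otimes> inv (E k \<otimes> E l)) \<longleftrightarrow> x k + x l \<le> x i + x j"
proof -
  define ev where "ev f = (\<Otimes>i\<in>J. E i [^] (f i :: int))" for f
  have E [simp]: "E i \<in> carrier G" if "i \<in> J" for i using J that by auto
  have ev_closed [simp]: "ev f \<in> carrier G" for f
    unfolding ev_def by (intro finprod_closed) auto
  have ev_add: "ev (\<lambda>i. f i + g i) = ev f \<otimes> ev g" for f g
  proof -
    have "ev (\<lambda>i. f i + g i) = (\<Otimes>i\<in>J. E i [^] f i \<otimes> E i [^] g i)"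
      unfolding ev_def by (intro finprod_cong') (auto simp: int_pow_mult)
    then show ?thesis unfolding ev_def by (subst finprod_multf[symmetric]) auto
  qed
  have "ev (\<lambda>i. 0) = \<one>" by (simp add: ev_def)
  then have ev_neg: "ev (\<lambda>i. - f i) = inv (ev f)" for f
    using ev_add[of "\<lambda>i. - f i" f] by (simp add: inv_equality)
  \<comment> \<open>\<open>b i\<close> is the unit vector at \<open>i\<close>, so the vectors
    \<open>w i j k l\<close> below are the exponents of the quotients to be compared.\<close>
  define b where "b i j = (if i = j then 1 else 0 :: int)" for i j :: 'i
  have ev_b: "ev (b i) = E i" if "i \<in> J" for i
  proof -
    have "ev (b i) = (\<Otimes>j\<in>J. if i = j then E j else \<one>)"
      unfolding ev_def by (intro finprod_cong') (auto simp: b_def)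
    then show ?thesis using finprod_singleton[OF that J] by simp
  qed
  define w where "w i j k l = (\<lambda>m. (b i m + b j m) + - (b k m + b l m))" for i j k l
  interpret total_cone "\<lambda>f. N (ev f)"
    by unfold_locales (simp_all add: ev_add ev_neg N_mult N_total)
  let ?F = "(\<lambda>(i, j, k, l). w i j k l) ` (J \<times> J \<times> J \<times> J)"
  have "\<exists>x :: 'i \<Rightarrow> real. \<forall>f\<in>?F. N (ev f) \<longleftrightarrow> 0 \<le> (\<Sum>m\<in>J. of_int (f m) * x m)"
    using J by (intro represented_by_functional) (auto simp: w_def b_def)
  then obtain x :: "'i \<Rightarrow> real"
    where x: "\<And>f. f \<in> ?F \<Longrightarrow> N (ev f) \<longleftrightarrow> 0 \<le> (\<Sum>m\<in>J. of_int (f m) * x m)"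
    by blast
  show ?thesis
  proof (intro exI[of _ x] ballI)
    fix i j k l assume ijkl: "i \<in> J" "j \<in> J" "k \<in> J" "l \<in> J"
    have sum_b: "(\<Sum>m\<in>J. of_int (b i m) * x m) = x i" if "i \<in> J" for i
    proof -
      have "(\<Sum>m\<in>J. of_int (b i m) * x m) = (\<Sum>m\<in>J. if i = m then x m else 0)"
        by (intro sum.cong) (auto simp: b_def)
      then show ?thesis using J that by simp
    qed
    have "(\<Sum>m\<in>J. of_int (w i j k l m) * x m) = x i + x j - (x k + x l)"
      using ijkl by (simp add: w_def distrib_right left_diff_distrib sum.distrib sum_subtractf sum_negf sum_b)
    moreover have "ev (w i j k l) = (E i \<otimes> E j) \<otimes> inv (E k \<otimes> E l)"
      unfolding w_def ev_add ev_neg using ijkl by (simp add: ev_add ev_b)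
    moreover have "w i j k l \<in> ?F" using ijkl by force
    ultimately show "N ((E i \<otimes> E j) \<otimes> inv (E k \<otimes> E l)) \<longleftrightarrow> x k + x l \<le> x i + x j"
      using x[of "w i j k l"] by simp
  qed
qed

end

section \<open>MV-algebras, ideals and quotients\<close>

context mv_algebra
begin

abbreviation le (infix "\<preceq>" 50) where "x \<preceq> y \<equiv> mv_le A x y"
abbreviation diff (infixl "\<ominus>" 65) where "x \<ominus> y \<equiv> mv_minus A x y"

lemmas [simp] = plus_closed neg_closed zero_closed plus_zero neg_neg plus_one

lemma minus_closed [simp]: "x \<in> carrier A \<Longrightarrow> y \<in> carrier A \<Longrightarrow> x \<ominus> y \<in> carrier A"
  by (simp add: mv_minus_def)

lemma zero_plus [simp]: "x \<in> carrier A \<Longrightarrow> \<zero> \<oplus> x = x"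
  by (metis plus_comm plus_zero zero_closed)

lemma one_plus [simp]: "x \<in> carrier A \<Longrightarrow> \<sim> \<zero> \<oplus> x = \<sim> \<zero>"
  by (metis plus_comm plus_one zero_closed neg_closed)

lemma plus_left_comm:
  "x \<in> carrier A \<Longrightarrow> y \<in> carrier A \<Longrightarrow> z \<in> carrier A \<Longrightarrow> y \<oplus> (x \<oplus> z) = x \<oplus> (y \<oplus> z)"
  by (metis plus_assoc plus_comm)

lemma neg_plus_self [simp]: "x \<in> carrier A \<Longrightarrow> \<sim> x \<oplus> x = \<sim> \<zero>"
  using luk[of x "\<sim> \<zero>"] by simp

lemma plus_neg_self [simp]: "x \<in> carrier A \<Longrightarrow> x \<oplus> \<sim> x = \<sim> \<zero>"
  by (metis neg_plus_self plus_comm neg_closed)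

lemma neg_inject: "x \<in> carrier A \<Longrightarrow> y \<in> carrier A \<Longrightarrow> \<sim> x = \<sim> y \<longleftrightarrow> x = y"
  by (metis neg_neg)

lemma le_refl [simp]: "x \<in> carrier A \<Longrightarrow> x \<preceq> x"
  by (simp add: mv_le_def)

lemma zero_le [simp]: "x \<in> carrier A \<Longrightarrow> \<zero> \<preceq> x"
  by (simp add: mv_le_def)

lemma le_one [simp]: "x \<in> carrier A \<Longrightarrow> x \<preceq> \<sim> \<zero>"
  by (simp add: mv_le_def)

lemma le_antisym: "x \<preceq> y \<Longrightarrow> y \<preceq> x \<Longrightarrow> x \<in> carrier A \<Longrightarrow> y \<in> carrier A \<Longrightarrow> x = y"
  using luk[of x y] by (simp add: mv_le_def)

lemma le_zero_iff [simp]: "x \<in> carrier A \<Longrightarrow> x \<preceq> \<zero> \<longleftrightarrow> x = \<zero>"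
  by (metis le_antisym zero_le zero_closed)

lemma minus_plus_cancel: "x \<preceq> y \<Longrightarrow> x \<in> carrier A \<Longrightarrow> y \<in> carrier A \<Longrightarrow> (y \<ominus> x) \<oplus> x = y"
  using luk[of x y] by (simp add: mv_le_def mv_minus_def)

lemma le_plus1 [simp]: "x \<in> carrier A \<Longrightarrow> y \<in> carrier A \<Longrightarrow> x \<preceq> x \<oplus> y"
  by (simp add: mv_le_def plus_assoc)

lemma le_plus2 [simp]: "x \<in> carrier A \<Longrightarrow> y \<in> carrier A \<Longrightarrow> y \<preceq> x \<oplus> y"
  by (metis le_plus1 plus_comm)

lemma le_trans:
  assumes "x \<preceq> y" "y \<preceq> z" "x \<in> carrier A" "y \<in> carrier A" "z \<in> carrier A" shows "x \<preceq> z"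
proof -
  have "z = ((z \<ominus> y) \<oplus> (y \<ominus> x)) \<oplus> x"
    using assms by (simp add: minus_plus_cancel flip: plus_assoc)
  then show ?thesis using assms by (metis le_plus2 plus_closed minus_closed)
qed

lemma minus_le_iff:
  "x \<in> carrier A \<Longrightarrow> y \<in> carrier A \<Longrightarrow> z \<in> carrier A \<Longrightarrow> x \<ominus> y \<preceq> z \<longleftrightarrow> x \<preceq> y \<oplus> z"
  by (simp add: mv_le_def mv_minus_def plus_assoc)

lemma plus_mono:
  assumes "x \<preceq> y" "z \<preceq> w" "x \<in> carrier A" "y \<in> carrier A" "z \<in> carrier A" "w \<in> carrier A"
  shows "x \<oplus> z \<preceq> y \<oplus> w"
proof -
  have "(y \<ominus> x) \<oplus> x \<oplus> ((w \<ominus> z) \<oplus> z) = ((y \<ominus> x) \<oplus> (w \<ominus> z)) \<oplus> (x \<oplus> z)"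
    using assms by (simp add: plus_left_comm flip: plus_assoc)
  then show ?thesis using assms by (metis le_plus2 minus_closed minus_plus_cancel plus_closed)
qed

lemma neg_le_iff: "x \<in> carrier A \<Longrightarrow> y \<in> carrier A \<Longrightarrow> \<sim> x \<preceq> \<sim> y \<longleftrightarrow> y \<preceq> x"
  by (simp add: mv_le_def plus_comm)

lemma minus_le_self [simp]: "x \<in> carrier A \<Longrightarrow> y \<in> carrier A \<Longrightarrow> x \<ominus> y \<preceq> x"
  by (simp add: minus_le_iff)

lemma minus_le_neg [simp]: "x \<in> carrier A \<Longrightarrow> y \<in> carrier A \<Longrightarrow> x \<ominus> y \<preceq> \<sim> y"
  by (simp add: minus_le_iff)

lemma le_minus_plus: "x \<in> carrier A \<Longrightarrow> y \<in> carrier A \<Longrightarrow> x \<preceq> y \<oplus> (x \<ominus> y)"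
  by (metis minus_le_iff minus_closed le_refl)

lemma minus_eq_zero_iff: "x \<in> carrier A \<Longrightarrow> y \<in> carrier A \<Longrightarrow> x \<ominus> y = \<zero> \<longleftrightarrow> x \<preceq> y"
  by (metis le_zero_iff minus_closed minus_le_iff plus_zero zero_closed)

lemma minus_neg_neg: "x \<in> carrier A \<Longrightarrow> y \<in> carrier A \<Longrightarrow> \<sim> x \<ominus> \<sim> y = y \<ominus> x"
  by (simp add: mv_minus_def plus_comm)

lemma minus_triangle:
  assumes "x \<in> carrier A" "y \<in> carrier A" "z \<in> carrier A"
  shows "x \<ominus> z \<preceq> (x \<ominus> y) \<oplus> (y \<ominus> z)"
proof -
  have "x \<preceq> y \<oplus> (x \<ominus> y)" using assms by (simp add: le_minus_plus)
  moreover have "y \<oplus> (x \<ominus> y) \<preceq> (z \<oplus> (y \<ominus> z)) \<oplus> (x \<ominus> y)"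
    using assms by (intro plus_mono le_minus_plus) auto
  ultimately have "x \<preceq> (z \<oplus> (y \<ominus> z)) \<oplus> (x \<ominus> y)"
    by (rule le_trans) (use assms in auto)
  then show ?thesis using assms
    by (simp add: minus_le_iff plus_comm plus_left_comm flip: plus_assoc)
qed

lemma minus_plus_plus_le:
  assumes "x \<in> carrier A" "y \<in> carrier A" "x' \<in> carrier A" "y' \<in> carrier A"
  shows "(x \<oplus> y) \<ominus> (x' \<oplus> y') \<preceq> (x \<ominus> x') \<oplus> (y \<ominus> y')"
proof -
  have "x \<oplus> y \<preceq> (x' \<oplus> (x \<ominus> x')) \<oplus> (y' \<oplus> (y \<ominus> y'))"
    using assms by (intro plus_mono le_minus_plus) auto
  then show ?thesis using assms by (simp add: minus_le_iff plus_left_comm flip: plus_assoc)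
qed

text \<open>The bound on \<open>x\<close> says that the sum is not truncated, so subtraction can
  undo it.\<close>

lemma plus_minus_cancel:
  assumes "x \<preceq> \<sim> y" "x \<in> carrier A" "y \<in> carrier A"
  shows "(x \<oplus> y) \<ominus> y = x"
proof -
  have "y \<preceq> \<sim> x" using assms neg_le_iff[of "\<sim> y" x] by simp
  then have "(\<sim> x \<ominus> y) \<oplus> y = \<sim> x" using assms by (simp add: minus_plus_cancel)
  then show ?thesis using assms by (metis mv_minus_def neg_neg)
qed

text \<open>The meet of \<open>x\<close> and \<open>y\<close> is zero, expressed through common
  lower bounds instead of a lattice operation.\<close>

definition orthogonal where "orthogonal x y \<longleftrightarrow> (\<forall>z\<in>carrier A. z \<preceq> x \<longrightarrow> z \<preceq> y \<longrightarrow> z = \<zero>)"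

lemma orthogonal_sym: "orthogonal x y \<Longrightarrow> orthogonal y x"
  by (auto simp: orthogonal_def)

lemma orthogonal_zero: "orthogonal x \<zero>"
  by (simp add: orthogonal_def)

text \<open>If \<open>w\<close> lies below both sides, then \<open>w \<ominus> y\<close> lies below
  \<open>x\<close> and \<open>z\<close>, hence vanishes, which puts \<open>w\<close> below
  \<open>y\<close>.\<close>

lemma orthogonal_plus:
  assumes "orthogonal x y" "orthogonal x z" "x \<in> carrier A" "y \<in> carrier A" "z \<in> carrier A"
  shows "orthogonal x (y \<oplus> z)"
  unfolding orthogonal_def
proof (intro ballI impI)
  fix w assume w: "w \<in> carrier A" "w \<preceq> x" "w \<preceq> y \<oplus> z"
  then have "w \<ominus> y \<preceq> z" using assms by (simp add: minus_le_iff)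
  moreover have "w \<ominus> y \<preceq> x" using assms w by (rule_tac le_trans[of _ w]) auto
  ultimately have "w \<ominus> y = \<zero>" using assms(2,4) w(1) unfolding orthogonal_def by simp
  then have "w \<preceq> y" using assms w by (simp add: minus_eq_zero_iff)
  then show "w = \<zero>" using assms(1) w unfolding orthogonal_def by blast
qed

lemma minus_antimono:
  assumes "z \<preceq> y" "x \<in> carrier A" "y \<in> carrier A" "z \<in> carrier A"
  shows "x \<ominus> y \<preceq> x \<ominus> z"
proof -
  have "x \<preceq> z \<oplus> (x \<ominus> z)" using assms by (simp add: le_minus_plus)
  moreover have "z \<oplus> (x \<ominus> z) \<preceq> y \<oplus> (x \<ominus> z)" using assms by (simp add: plus_mono)
  ultimately have "x \<preceq> y \<oplus> (x \<ominus> z)" by (rule le_trans) (use assms in auto)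
  then show ?thesis using assms by (simp add: minus_le_iff)
qed

lemma le_neg_swap: "x \<in> carrier A \<Longrightarrow> y \<in> carrier A \<Longrightarrow> x \<preceq> \<sim> y \<longleftrightarrow> y \<preceq> \<sim> x"
  using neg_le_iff[of "\<sim> x" y] by simp

lemma minus_minus_cancel:
  assumes "y \<preceq> x" "x \<in> carrier A" "y \<in> carrier A"
  shows "x \<ominus> (x \<ominus> y) = y"
proof -
  have "y \<preceq> \<sim> (x \<ominus> y)" using assms by (simp add: le_neg_swap[of y])
  then show ?thesis
    using plus_minus_cancel[of y "x \<ominus> y"] minus_plus_cancel[of y x] assms
    by (simp add: plus_comm[of y])
qed

text \<open>Both sides are the meet of \<open>x\<close> and \<open>y\<close>; this is the axiom
  \<open>luk\<close> in De Morgan dual form.\<close>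

lemma minus_minus_commute:
  "x \<in> carrier A \<Longrightarrow> y \<in> carrier A \<Longrightarrow> x \<ominus> (x \<ominus> y) = y \<ominus> (y \<ominus> x)"
  using luk[of "\<sim> x" "\<sim> y"]
  by (simp add: mv_minus_def plus_comm[of "\<sim> x"] plus_comm[of "\<sim> y"])

text \<open>In the unit interval one of the two differences is zero. Here a common lower bound
  \<open>d\<close> can be added to the meet \<open>m\<close> while staying below both
  \<open>x\<close> and \<open>y\<close>, so it adds nothing to \<open>m\<close>.\<close>

lemma orthogonal_minus_minus:
  assumes xy: "x \<in> carrier A" "y \<in> carrier A"
  shows "orthogonal (x \<ominus> y) (y \<ominus> x)"
  unfolding orthogonal_def
proof (intro ballI impI)
  fix d assume d: "d \<in> carrier A" "d \<preceq> x \<ominus> y" "d \<preceq> y \<ominus> x"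
  define m where "m = x \<ominus> (x \<ominus> y)"
  have m': "m = y \<ominus> (y \<ominus> x)" unfolding m_def using xy by (rule minus_minus_commute)
  have mc [simp]: "m \<in> carrier A" using xy by (simp add: m_def)
  have "m \<oplus> (x \<ominus> y) = x" unfolding m_def using xy by (simp add: minus_plus_cancel)
  moreover have "m \<oplus> (y \<ominus> x) = y" unfolding m' using xy by (simp add: minus_plus_cancel)
  moreover have "m \<oplus> d \<preceq> m \<oplus> (x \<ominus> y)" "m \<oplus> d \<preceq> m \<oplus> (y \<ominus> x)"
    using d xy by (simp_all add: plus_mono)
  ultimately have *: "m \<oplus> d \<preceq> x" "m \<oplus> d \<preceq> y" by simp_all
  \<comment> \<open>Subtracting from \<open>x\<close> twice is monotone, sends \<open>y\<close> to
    the meet and fixes everything below \<open>x\<close>.\<close>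
  have "x \<ominus> (x \<ominus> (m \<oplus> d)) \<preceq> m"
    by (subst (2) m_def, intro minus_antimono) (use * d xy in auto)
  then have "m \<oplus> d \<preceq> m" using * d xy by (simp add: minus_minus_cancel)
  then have "d \<oplus> m = m" using d plus_comm[of d m] by (simp add: le_antisym)
  \<comment> \<open>Since \<open>d\<close> also lies below the negation of \<open>m\<close>, its sum
    with \<open>m\<close> is untruncated and can be cancelled.\<close>
  moreover have "m \<preceq> y" using xy m' by simp
  then have "\<sim> y \<preceq> \<sim> m" using xy by (simp add: neg_le_iff)
  then have "x \<ominus> y \<preceq> \<sim> m" using xy by (rule_tac le_trans[of _ "\<sim> y"]) auto
  then have "d \<preceq> \<sim> m" using d xy by (rule_tac le_trans[of _ "x \<ominus> y"]) auto
  ultimately have "d = m \<ominus> m" using plus_minus_cancel[of d m] d by simp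
  then show "d = \<zero>" by (simp add: minus_eq_zero_iff)
qed

definition times :: "nat \<Rightarrow> 'a \<Rightarrow> 'a" where "times k x = ((\<oplus>) x ^^ k) \<zero>"

lemma times_0 [simp]: "times 0 x = \<zero>" and times_Suc [simp]: "times (Suc k) x = x \<oplus> times k x"
  by (simp_all add: times_def)

lemma times_closed [simp]: "x \<in> carrier A \<Longrightarrow> times k x \<in> carrier A"
  by (induction k) auto

lemma times_add: "x \<in> carrier A \<Longrightarrow> times (k + l) x = times k x \<oplus> times l x"
  by (induction k) (auto simp: plus_assoc)

lemma orthogonal_times: "orthogonal x y \<Longrightarrow> x \<in> carrier A \<Longrightarrow> y \<in> carrier A \<Longrightarrow> orthogonal x (times k y)"
  by (induction k) (simp_all add: orthogonal_plus orthogonal_zero)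

end

section \<open>Ideals, congruences and quotients\<close>

context mv_algebra
begin

lemma ideal_subset: "mv_ideal A I \<Longrightarrow> I \<subseteq> carrier A"
  and ideal_zero: "mv_ideal A I \<Longrightarrow> \<zero> \<in> I"
  and ideal_plus: "mv_ideal A I \<Longrightarrow> x \<in> I \<Longrightarrow> y \<in> I \<Longrightarrow> x \<oplus> y \<in> I"
  and ideal_down: "mv_ideal A I \<Longrightarrow> x \<in> I \<Longrightarrow> y \<preceq> x \<Longrightarrow> y \<in> carrier A \<Longrightarrow> y \<in> I"
  by (auto simp: mv_ideal_def)

lemma ideal_plus_iff:
  assumes "mv_ideal A I" "x \<in> carrier A" "y \<in> carrier A"
  shows "x \<oplus> y \<in> I \<longleftrightarrow> x \<in> I \<and> y \<in> I"
  using assms ideal_plus[of I x y] ideal_down[of I "x \<oplus> y" x] ideal_down[of I "x \<oplus> y" y] by auto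

lemma dist_mem_iff:
  assumes "mv_ideal A I" "x \<in> carrier A" "y \<in> carrier A"
  shows "mv_dist A x y \<in> I \<longleftrightarrow> x \<ominus> y \<in> I \<and> y \<ominus> x \<in> I"
  using assms by (simp add: mv_dist_def ideal_plus_iff)

lemma ideal_minus_trans:
  assumes "mv_ideal A I" "x \<ominus> y \<in> I" "y \<ominus> z \<in> I"
    "x \<in> carrier A" "y \<in> carrier A" "z \<in> carrier A"
  shows "x \<ominus> z \<in> I"
  using assms ideal_down[OF assms(1) ideal_plus[OF assms(1-3)]] by (simp add: minus_triangle)

lemma minus_self [simp]: "x \<in> carrier A \<Longrightarrow> x \<ominus> x = \<zero>"
  by (simp add: minus_eq_zero_iff)

lemma cong_iff:
  assumes "mv_ideal A I"
  shows "(x, y) \<in> mv_cong A I \<longleftrightarrow>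
    x \<in> carrier A \<and> y \<in> carrier A \<and> x \<ominus> y \<in> I \<and> y \<ominus> x \<in> I"
  using assms by (auto simp: mv_cong_def dist_mem_iff)

lemma equiv_cong:
  assumes "mv_ideal A I"
  shows "equiv (carrier A) (mv_cong A I)"
proof (rule equivI)
  show "mv_cong A I \<subseteq> carrier A \<times> carrier A" by (auto simp: mv_cong_def)
  show "refl_on (carrier A) (mv_cong A I)"
    using assms by (auto simp: refl_on_def cong_iff ideal_zero)
  show "sym (mv_cong A I)" using assms by (auto simp: sym_def cong_iff)
  show "trans (mv_cong A I)"
    using assms by (auto simp: trans_def cong_iff intro: ideal_minus_trans)
qed

abbreviation coset ("\<lbrakk>_\<rbrakk>\<^bsub>_\<^esub>") where "\<lbrakk>x\<rbrakk>\<^bsub>I\<^esub> \<equiv> mv_cong A I `` {x}"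

context
  fixes I assumes I: "mv_ideal A I"
begin

lemma coset_eq_iff:
  "x \<in> carrier A \<Longrightarrow> y \<in> carrier A \<Longrightarrow> \<lbrakk>x\<rbrakk>\<^bsub>I\<^esub> = \<lbrakk>y\<rbrakk>\<^bsub>I\<^esub> \<longleftrightarrow> x \<ominus> y \<in> I \<and> y \<ominus> x \<in> I"
  by (simp add: eq_equiv_class_iff[OF equiv_cong[OF I]] cong_iff[OF I])

lemma coset_eq_zero_iff: "x \<in> carrier A \<Longrightarrow> \<lbrakk>x\<rbrakk>\<^bsub>I\<^esub> = \<lbrakk>\<zero>\<rbrakk>\<^bsub>I\<^esub> \<longleftrightarrow> x \<in> I"
  using coset_eq_iff[of x \<zero>] ideal_zero[OF I]
  by (simp add: minus_eq_zero_iff[THEN iffD2] mv_minus_def)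

lemma quotient_carrier: "carrier (mv_quotient A I) = (\<lambda>x. \<lbrakk>x\<rbrakk>\<^bsub>I\<^esub>) ` carrier A"
  by (auto simp: mv_quotient_def quotient_def)

lemma quotient_zero: "mv_zero (mv_quotient A I) = \<lbrakk>\<zero>\<rbrakk>\<^bsub>I\<^esub>"
  by (simp add: mv_quotient_def)

lemma quotient_neg:
  assumes "x \<in> carrier A" shows "mv_neg (mv_quotient A I) \<lbrakk>x\<rbrakk>\<^bsub>I\<^esub> = \<lbrakk>\<sim> x\<rbrakk>\<^bsub>I\<^esub>"
proof -
  have "(\<lambda>x. \<lbrakk>\<sim> x\<rbrakk>\<^bsub>I\<^esub>) respects mv_cong A I"
    by (rule congruentI) (simp add: cong_iff[OF I] coset_eq_iff minus_neg_neg)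
  then show ?thesis
    using assms by (simp add: mv_quotient_def UN_equiv_class[OF equiv_cong[OF I]])
qed

lemma quotient_plus:
  assumes "x \<in> carrier A" "y \<in> carrier A"
  shows "mv_plus (mv_quotient A I) \<lbrakk>x\<rbrakk>\<^bsub>I\<^esub> \<lbrakk>y\<rbrakk>\<^bsub>I\<^esub> = \<lbrakk>x \<oplus> y\<rbrakk>\<^bsub>I\<^esub>"
proof -
  have *: "(x \<oplus> y) \<ominus> (x' \<oplus> y') \<in> I"
    if "x \<ominus> x' \<in> I" "y \<ominus> y' \<in> I"
      "x \<in> carrier A" "y \<in> carrier A" "x' \<in> carrier A" "y' \<in> carrier A" for x y x' y'
    using ideal_down[OF I ideal_plus[OF I that(1,2)]] that by (simp add: minus_plus_plus_le)
  have "(\<lambda>x y. \<lbrakk>x \<oplus> y\<rbrakk>\<^bsub>I\<^esub>) respects2 mv_cong A I"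
    by (rule congruent2I') (simp add: cong_iff[OF I] coset_eq_iff *)
  then show ?thesis
    using assms by (simp add: mv_quotient_def UN_equiv_class2[OF equiv_cong[OF I] equiv_cong[OF I]])
qed

lemmas quotient_simps = quotient_carrier quotient_zero quotient_neg quotient_plus

lemma quotient_mv_algebra: "mv_algebra (mv_quotient A I)"
proof
  fix X Y Z
  assume "X \<in> carrier (mv_quotient A I)" "Y \<in> carrier (mv_quotient A I)" "Z \<in> carrier (mv_quotient A I)"
  then obtain x y z where "x \<in> carrier A" "X = \<lbrakk>x\<rbrakk>\<^bsub>I\<^esub>" "y \<in> carrier A" "Y = \<lbrakk>y\<rbrakk>\<^bsub>I\<^esub>"
    "z \<in> carrier A" "Z = \<lbrakk>z\<rbrakk>\<^bsub>I\<^esub>"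
    by (auto simp: quotient_carrier)
  then show "X \<oplus>\<^bsub>mv_quotient A I\<^esub> (Y \<oplus>\<^bsub>mv_quotient A I\<^esub> Z) =
      X \<oplus>\<^bsub>mv_quotient A I\<^esub> Y \<oplus>\<^bsub>mv_quotient A I\<^esub> Z"
    by (simp add: quotient_simps plus_assoc)
next
  fix X Y
  assume "X \<in> carrier (mv_quotient A I)" "Y \<in> carrier (mv_quotient A I)"
  then obtain x y where *: "x \<in> carrier A" "X = \<lbrakk>x\<rbrakk>\<^bsub>I\<^esub>" "y \<in> carrier A" "Y = \<lbrakk>y\<rbrakk>\<^bsub>I\<^esub>"
    by (auto simp: quotient_carrier)
  show "X \<oplus>\<^bsub>mv_quotient A I\<^esub> Y = Y \<oplus>\<^bsub>mv_quotient A I\<^esub> X"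
    using * by (simp add: quotient_simps plus_comm)
  show "\<sim>\<^bsub>mv_quotient A I\<^esub> (\<sim>\<^bsub>mv_quotient A I\<^esub> X \<oplus>\<^bsub>mv_quotient A I\<^esub> Y) \<oplus>\<^bsub>mv_quotient A I\<^esub> Y =
      \<sim>\<^bsub>mv_quotient A I\<^esub> (\<sim>\<^bsub>mv_quotient A I\<^esub> Y \<oplus>\<^bsub>mv_quotient A I\<^esub> X) \<oplus>\<^bsub>mv_quotient A I\<^esub> X"
    using * luk[of x y] by (simp add: quotient_simps)
qed (auto simp: quotient_simps)

end

section \<open>Prime ideals and linearly ordered quotients\<close>

definition prime_ideal :: "'a set \<Rightarrow> bool" where
  "prime_ideal P \<longleftrightarrow> mv_ideal A P \<and> P \<noteq> carrier A \<and>
    (\<forall>x\<in>carrier A. \<forall>y\<in>carrier A. x \<ominus> y \<in> P \<or> y \<ominus> x \<in> P)"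

text \<open>For an ideal \<open>I\<close> and \<open>a\<close> in the carrier, this is the ideal
  generated by both.\<close>

definition ideal_insert :: "'a \<Rightarrow> 'a set \<Rightarrow> 'a set" where
  "ideal_insert a I = {z \<in> carrier A. \<exists>c\<in>I. \<exists>k. z \<preceq> c \<oplus> times k a}"

lemma ideal_insert:
  assumes I: "mv_ideal A I" and a: "a \<in> carrier A"
  shows "mv_ideal A (ideal_insert a I)" "I \<subseteq> ideal_insert a I" "a \<in> ideal_insert a I"
proof -
  have Ic: "c \<in> carrier A" if "c \<in> I" for c using that ideal_subset[OF I] by auto
  show sub: "I \<subseteq> ideal_insert a I"
  proof
    fix c assume c: "c \<in> I"
    then have "c \<preceq> c \<oplus> times 0 a" using Ic by simp
    then show "c \<in> ideal_insert a I" using c Ic unfolding ideal_insert_def by blast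
  qed
  show "a \<in> ideal_insert a I"
    using a ideal_zero[OF I] by (auto simp: ideal_insert_def intro!: bexI[of _ \<zero>] exI[of _ 1])
  show "mv_ideal A (ideal_insert a I)"
    unfolding mv_ideal_def
  proof (intro conjI ballI impI)
    show "ideal_insert a I \<subseteq> carrier A" by (auto simp: ideal_insert_def)
    show "\<zero> \<in> ideal_insert a I" using sub ideal_zero[OF I] by auto
  next
    fix x y assume "x \<in> ideal_insert a I" "y \<in> ideal_insert a I"
    then obtain c k d l where x: "x \<in> carrier A" "c \<in> I" "x \<preceq> c \<oplus> times k a"
      and y: "y \<in> carrier A" "d \<in> I" "y \<preceq> d \<oplus> times l a"
      by (auto simp: ideal_insert_def)
    have "x \<oplus> y \<preceq> (c \<oplus> times k a) \<oplus> (d \<oplus> times l a)"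
      using x y a Ic by (intro plus_mono) auto
    also have "(c \<oplus> times k a) \<oplus> (d \<oplus> times l a) = (c \<oplus> d) \<oplus> times (k + l) a"
      using x y a Ic by (simp add: times_add plus_left_comm flip: plus_assoc)
    finally show "x \<oplus> y \<in> ideal_insert a I"
      using x y ideal_plus[OF I, of c d] by (auto simp: ideal_insert_def)
  next
    fix x y assume x: "x \<in> ideal_insert a I" and y: "y \<in> carrier A" "y \<preceq> x"
    obtain c k where c: "x \<in> carrier A" "c \<in> I" "x \<preceq> c \<oplus> times k a"
      using x unfolding ideal_insert_def by blast
    have "y \<preceq> c \<oplus> times k a"
      using y c a Ic[of c] by (rule_tac le_trans[of y x]) simp_all
    then show "y \<in> ideal_insert a I"
      using y c unfolding ideal_insert_def by blast
  qed
qed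

text \<open>An ideal maximal among those avoiding \<open>b\<close> is prime: were both differences
  outside, the part of \<open>b\<close> left after subtracting an element of the ideal would lie
  below multiples of two orthogonal elements, hence be zero, and \<open>b\<close> would be in the
  ideal.\<close>

lemma exists_prime_ideal:
  assumes b: "b \<in> carrier A" "b \<noteq> \<zero>"
  obtains P where "prime_ideal P" "b \<notin> P"
proof -
  let ?S = "{I. mv_ideal A I \<and> b \<notin> I}"
  have "{\<zero>} \<in> ?S" using b by (auto simp: mv_ideal_def)
  then have ne: "?S \<noteq> {}" by blast
  have un: "\<Union>\<C> \<in> ?S" if "\<C> \<noteq> {}" "subset.chain ?S \<C>" for \<C>
  proof -
    have C: "mv_ideal A I" "b \<notin> I" if "I \<in> \<C>" for I
      using \<open>subset.chain ?S \<C>\<close> that by (auto simp: subset.chain_def)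
    have dir: "\<exists>K\<in>\<C>. x \<in> K \<and> y \<in> K" if "x \<in> I" "y \<in> J" "I \<in> \<C>" "J \<in> \<C>" for x y I J
      using \<open>subset.chain ?S \<C>\<close> that unfolding subset.chain_def by blast
    have "mv_ideal A (\<Union>\<C>)"
      unfolding mv_ideal_def
    proof (intro conjI ballI impI)
      show "\<Union>\<C> \<subseteq> carrier A" using C ideal_subset by blast
      show "\<zero> \<in> \<Union>\<C>" using C ideal_zero \<open>\<C> \<noteq> {}\<close> by blast
      show "x \<oplus> y \<in> \<Union>\<C>" if "x \<in> \<Union>\<C>" "y \<in> \<Union>\<C>" for x y
        using that dir C ideal_plus by (metis Union_iff)
      show "y \<in> \<Union>\<C>" if "x \<in> \<Union>\<C>" "y \<in> carrier A" "y \<preceq> x" for x y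
        using that C ideal_down by (metis Union_iff)
    qed
    then show ?thesis using C by auto
  qed
  obtain P where P: "mv_ideal A P" "b \<notin> P"
    and max: "\<And>I. mv_ideal A I \<Longrightarrow> b \<notin> I \<Longrightarrow> P \<subseteq> I \<Longrightarrow> I = P"
    using subset_Zorn_nonempty[OF ne un] by auto
  \<comment> \<open>By maximality, adjoining any outside element to \<open>P\<close> captures
    \<open>b\<close>.\<close>
  have bound: "\<exists>c\<in>P. \<exists>k. b \<ominus> c \<preceq> times k a" if "a \<in> carrier A" "a \<notin> P" for a
  proof -
    have "b \<in> ideal_insert a P"
      using ideal_insert[OF P(1), of a] max[of "ideal_insert a P"] that by blast
    then obtain c k where c: "c \<in> P" "b \<preceq> c \<oplus> times k a"
      unfolding ideal_insert_def by blast
    then have "b \<ominus> c \<preceq> times k a"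
      using that b ideal_subset[OF P(1)] by (auto simp: minus_le_iff)
    then show ?thesis using c by blast
  qed
  have "x \<ominus> y \<in> P \<or> y \<ominus> x \<in> P" if xy: "x \<in> carrier A" "y \<in> carrier A" for x y
  proof (rule ccontr)
    assume "\<not> ?thesis"
    then obtain c k d l where cd: "c \<in> P" "d \<in> P"
      and le: "b \<ominus> c \<preceq> times k (x \<ominus> y)" "b \<ominus> d \<preceq> times l (y \<ominus> x)"
      using bound[of "x \<ominus> y"] bound[of "y \<ominus> x"] xy by auto
    have car: "c \<in> carrier A" "d \<in> carrier A" using cd ideal_subset[OF P(1)] by auto
    \<comment> \<open>Subtracting \<open>c \<oplus> d\<close> makes both bounds available at
      once.\<close>
    let ?w = "b \<ominus> (c \<oplus> d)"
    have "?w \<preceq> b \<ominus> c" "?w \<preceq> b \<ominus> d" using car b by (auto intro: minus_antimono)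
    then have "?w \<preceq> times k (x \<ominus> y)" "?w \<preceq> times l (y \<ominus> x)"
      using le le_trans[of ?w "b \<ominus> c"] le_trans[of ?w "b \<ominus> d"] car b xy by auto
    moreover have "orthogonal (times k (x \<ominus> y)) (times l (y \<ominus> x))"
      using orthogonal_minus_minus xy by (intro orthogonal_times orthogonal_sym[OF orthogonal_times[OF orthogonal_sym]]) auto
    ultimately have "?w = \<zero>" using car b unfolding orthogonal_def by simp
    then have "b \<preceq> c \<oplus> d" using car b by (simp add: minus_eq_zero_iff)
    then show False using ideal_down[OF P(1) ideal_plus[OF P(1) cd]] b P(2) by simp
  qed
  then have "prime_ideal P" using P b by (auto simp: prime_ideal_def)
  then show thesis using that P by blast
qed

end

locale mv_chain = mv_algebra +
  assumes linear: "x \<in> carrier A \<Longrightarrow> y \<in> carrier A \<Longrightarrow> mv_le A x y \<or> mv_le A y x"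
    and nontrivial: "\<sim> \<zero> \<noteq> \<zero>"

lemma (in mv_algebra) quotient_prime_chain:
  assumes "prime_ideal P"
  shows "mv_chain (mv_quotient A P)"
proof -
  have P: "mv_ideal A P" using assms by (simp add: prime_ideal_def)
  interpret Q: mv_algebra "mv_quotient A P" by (rule quotient_mv_algebra[OF P])
  have minus: "Q.diff \<lbrakk>x\<rbrakk>\<^bsub>P\<^esub> \<lbrakk>y\<rbrakk>\<^bsub>P\<^esub> = \<lbrakk>x \<ominus> y\<rbrakk>\<^bsub>P\<^esub>"
    if "x \<in> carrier A" "y \<in> carrier A" for x y
    using that by (simp add: mv_minus_def quotient_simps[OF P])
  show ?thesis
  proof
    fix X Y assume "X \<in> carrier (mv_quotient A P)" "Y \<in> carrier (mv_quotient A P)"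
    then obtain x y where "x \<in> carrier A" "y \<in> carrier A" "X = \<lbrakk>x\<rbrakk>\<^bsub>P\<^esub>" "Y = \<lbrakk>y\<rbrakk>\<^bsub>P\<^esub>"
      by (auto simp: quotient_carrier[OF P])
    then have "Q.diff X Y = mv_zero (mv_quotient A P) \<or> Q.diff Y X = mv_zero (mv_quotient A P)"
      using assms by (auto simp: prime_ideal_def minus coset_eq_zero_iff[OF P] quotient_zero[OF P])
    then show "Q.le X Y \<or> Q.le Y X"
      using Q.minus_eq_zero_iff \<open>X \<in> _\<close> \<open>Y \<in> _\<close> by blast
  next
    have "\<sim> \<zero> \<notin> P"
      using assms ideal_down[OF P, of "\<sim> \<zero>"] ideal_subset[OF P] by (auto simp: prime_ideal_def)
    then show "mv_neg (mv_quotient A P) (mv_zero (mv_quotient A P)) \<noteq> mv_zero (mv_quotient A P)"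
      by (simp add: quotient_simps[OF P] coset_eq_zero_iff[OF P])
  qed
qed

section \<open>The totally ordered group of an MV-chain\<close>

context mv_algebra
begin

abbreviation odot (infixl "\<odot>" 70) where "x \<odot> y \<equiv> \<sim> (\<sim> x \<oplus> \<sim> y)"

text \<open>Both sums reach one, so \<odot> with \<open>y\<close> amounts to subtracting
  \<open>\<sim> y\<close>; both sides are then the sum of \<open>x \<ominus> \<sim> y\<close>,
  \<open>\<sim> y\<close> and \<open>z \<ominus> \<sim> y\<close>.\<close>

lemma odot_plus_swap:
  assumes "x \<oplus> y = \<sim> \<zero>" "y \<oplus> z = \<sim> \<zero>" "x \<in> carrier A" "y \<in> carrier A" "z \<in> carrier A"
  shows "(x \<odot> y) \<oplus> z = x \<oplus> (y \<odot> z)"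
proof -
  have "\<sim> y \<preceq> x" "\<sim> y \<preceq> z" using assms by (simp_all add: mv_le_def plus_comm)
  then have *: "(x \<ominus> \<sim> y) \<oplus> \<sim> y = x" "(z \<ominus> \<sim> y) \<oplus> \<sim> y = z"
    using assms by (simp_all add: minus_plus_cancel)
  have "(x \<ominus> \<sim> y) \<oplus> z = (x \<ominus> \<sim> y) \<oplus> ((z \<ominus> \<sim> y) \<oplus> \<sim> y)" by (simp add: *)
  also have "\<dots> = ((x \<ominus> \<sim> y) \<oplus> \<sim> y) \<oplus> (z \<ominus> \<sim> y)"
    using assms plus_comm[of "z \<ominus> \<sim> y" "\<sim> y"] by (simp add: plus_assoc)
  also have "\<dots> = x \<oplus> (z \<ominus> \<sim> y)" by (simp add: *)
  finally show ?thesis using assms by (simp add: mv_minus_def plus_comm)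
qed

lemma plus_odot_swap:
  assumes "\<sim> x \<oplus> \<sim> y = \<sim> \<zero>" "\<sim> y \<oplus> \<sim> z = \<sim> \<zero>"
    "x \<in> carrier A" "y \<in> carrier A" "z \<in> carrier A"
  shows "(x \<oplus> y) \<odot> z = x \<odot> (y \<oplus> z)"
  using odot_plus_swap[OF assms(1,2)] assms by simp

text \<open>The mixed carry: \<open>x\<close> and \<open>y\<close> together reach one while
  \<open>y\<close> and \<open>z\<close> do not exceed it, so x + y + z - 1 stays within bounds and
  neither side is truncated.\<close>

lemma odot_plus_assoc:
  assumes "x \<oplus> y = \<sim> \<zero>" "\<sim> y \<oplus> \<sim> z = \<sim> \<zero>"
    "x \<in> carrier A" "y \<in> carrier A" "z \<in> carrier A"
  shows "x \<odot> (y \<oplus> z) = (x \<odot> y) \<oplus> z"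
proof -
  have "\<sim> y \<preceq> x" "z \<preceq> \<sim> y" using assms by (simp_all add: mv_le_def plus_comm)
  then have *: "(x \<ominus> \<sim> y) \<oplus> \<sim> y = x" "(\<sim> y \<ominus> z) \<oplus> z = \<sim> y"
    using assms by (simp_all add: minus_plus_cancel)
  let ?d = "x \<ominus> \<sim> y" and ?e = "\<sim> y \<ominus> z"
  have "?d \<preceq> y" using minus_le_neg[of x "\<sim> y"] assms by simp
  then have "?d \<oplus> z \<preceq> \<sim> ?e" using assms by (simp add: mv_minus_def plus_mono)
  then have "((?d \<oplus> z) \<oplus> ?e) \<ominus> ?e = ?d \<oplus> z" using assms by (simp add: plus_minus_cancel)
  moreover have "(?d \<oplus> z) \<oplus> ?e = ?d \<oplus> (?e \<oplus> z)"
    using assms plus_comm[of ?e z] by (simp add: plus_assoc)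
  ultimately have "x \<ominus> ?e = ?d \<oplus> z" by (simp add: *)
  then show ?thesis using assms by (simp add: mv_minus_def)
qed

end

context mv_chain
begin

lemma plus_eq_one_cases:
  assumes "x \<in> carrier A" "y \<in> carrier A"
  shows "x \<oplus> y = \<sim> \<zero> \<or> \<sim> x \<oplus> \<sim> y = \<sim> \<zero>"
  using linear[of x "\<sim> y"] assms by (auto simp: mv_le_def plus_comm)

text \<open>Chang's totally ordered group of the chain: \<open>(k, x)\<close> stands for \<open>k \<cdot> u + x\<close>,
  where \<open>u\<close> is the unit, and the sum is formed with a carry.
  In the lexicographic order the positive cone is \<open>k \<ge> 0\<close>.\<close>

definition chang :: "(int \<times> 'a) monoid" where
  "chang = \<lparr>carrier = UNIV \<times> (carrier A - {\<sim> \<zero>}),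
    mult = (\<lambda>(k, x) (l, y). if x \<oplus> y = \<sim> \<zero> then (k + l + 1, x \<odot> y) else (k + l, x \<oplus> y)),
    one = (0, \<zero>)\<rparr>"

lemma carrier_chang: "(k, x) \<in> carrier chang \<longleftrightarrow> x \<in> carrier A \<and> x \<noteq> \<sim> \<zero>"
  by (simp add: chang_def)

lemma mult_chang: "(k, x) \<otimes>\<^bsub>chang\<^esub> (l, y) =
    (if x \<oplus> y = \<sim> \<zero> then (k + l + 1, x \<odot> y) else (k + l, x \<oplus> y))"
  by (simp add: chang_def)

lemma one_chang: "\<one>\<^bsub>chang\<^esub> = (0, \<zero>)"
  by (simp add: chang_def)

lemma odot_neq_one:
  assumes "x \<in> carrier A" "y \<in> carrier A" "x \<noteq> \<sim> \<zero>"
  shows "x \<odot> y \<noteq> \<sim> \<zero>"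
proof
  assume "x \<odot> y = \<sim> \<zero>"
  then have "\<sim> x \<oplus> \<sim> y = \<zero>" using assms by (metis neg_inject neg_closed plus_closed zero_closed)
  then have "\<sim> x \<preceq> \<zero>" using le_plus1[of "\<sim> x" "\<sim> y"] assms by simp
  then show False using assms by (metis le_zero_iff neg_closed neg_neg)
qed

text \<open>Whether the two adjacent pairs carry gives four cases. If both or neither do, the swap
  laws make the remaining carries agree; in the mixed cases the second carry on one side stands for
  the first carry on the other.\<close>

lemma mult_chang_assoc:
  assumes "x \<in> carrier A" "y \<in> carrier A" "z \<in> carrier A"
    and "x \<noteq> \<sim> \<zero>" "y \<noteq> \<sim> \<zero>" "z \<noteq> \<sim> \<zero>"
  shows "((k, x) \<otimes>\<^bsub>chang\<^esub> (l, y)) \<otimes>\<^bsub>chang\<^esub> (m, z) =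
    (k, x) \<otimes>\<^bsub>chang\<^esub> ((l, y) \<otimes>\<^bsub>chang\<^esub> (m, z))"
proof (cases "x \<oplus> y = \<sim> \<zero>")
  case xy: True
  show ?thesis
  proof (cases "y \<oplus> z = \<sim> \<zero>")
    case True
    then show ?thesis using xy odot_plus_swap[of x y z] assms
      by (simp add: mult_chang plus_assoc)
  next
    case False
    then have yz: "\<sim> y \<oplus> \<sim> z = \<sim> \<zero>" using plus_eq_one_cases assms by blast
    have "x \<oplus> (y \<oplus> z) = \<sim> \<zero>" using xy assms by (simp add: plus_assoc)
    then show ?thesis
      using odot_plus_assoc[OF xy yz] odot_neq_one[of x "y \<oplus> z"] xy False assms
      by (simp add: mult_chang)
  qed
next
  case False
  then have xy: "\<sim> x \<oplus> \<sim> y = \<sim> \<zero>" using plus_eq_one_cases assms by blast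
  show ?thesis
  proof (cases "y \<oplus> z = \<sim> \<zero>")
    case True
    have "(x \<oplus> y) \<oplus> z = \<sim> \<zero>" using True assms by (simp flip: plus_assoc)
    \<comment> \<open>This is the other mixed case read with the three elements in reverse
      order.\<close>
    moreover have "z \<odot> (y \<oplus> x) = (z \<odot> y) \<oplus> x"
      using odot_plus_assoc[of z y x] True xy assms by (simp add: plus_comm)
    then have "(x \<oplus> y) \<odot> z = x \<oplus> (y \<odot> z)" using assms by (simp add: plus_comm)
    moreover have "x \<oplus> (y \<odot> z) \<noteq> \<sim> \<zero>"
      using calculation(2) odot_neq_one[of z "x \<oplus> y"] assms by (simp add: plus_comm)
    ultimately show ?thesis using True False by (simp add: mult_chang)
  next
    case yz: False
    then have "\<sim> y \<oplus> \<sim> z = \<sim> \<zero>" using plus_eq_one_cases assms by blast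
    then show ?thesis using plus_odot_swap[OF xy] False yz assms
      by (simp add: mult_chang plus_assoc)
  qed
qed

text \<open>The negative of \<open>k \<cdot> u + x\<close> is -(k + 1) u + (u - x). For
  \<open>x = \<zero>\<close> the remainder would be the excluded top element, so nothing is borrowed
  there.\<close>

lemma chang_l_inv:
  assumes "x \<in> carrier A" "x \<noteq> \<sim> \<zero>"
  shows "(if x = \<zero> then (- k, \<zero>) else (- k - 1, \<sim> x)) \<otimes>\<^bsub>chang\<^esub> (k, x) = (0, \<zero>)"
  using assms nontrivial by (simp add: mult_chang)

lemma comm_group_chang: "comm_group chang"
proof (rule comm_groupI)
  fix a b c assume "a \<in> carrier chang" "b \<in> carrier chang" "c \<in> carrier chang"
  then show "a \<otimes>\<^bsub>chang\<^esub> b \<otimes>\<^bsub>chang\<^esub> c = a \<otimes>\<^bsub>chang\<^esub> (b \<otimes>\<^bsub>chang\<^esub> c)"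
    by (cases a; cases b; cases c) (simp add: carrier_chang mult_chang_assoc)
next
  fix a b assume "a \<in> carrier chang" "b \<in> carrier chang"
  then show "a \<otimes>\<^bsub>chang\<^esub> b = b \<otimes>\<^bsub>chang\<^esub> a" "a \<otimes>\<^bsub>chang\<^esub> b \<in> carrier chang"
    by (cases a; cases b; simp add: carrier_chang mult_chang plus_comm odot_neq_one)+
next
  fix a assume "a \<in> carrier chang"
  then obtain k x where a: "a = (k, x)" "x \<in> carrier A" "x \<noteq> \<sim> \<zero>"
    by (cases a) (auto simp: carrier_chang)
  then show "\<one>\<^bsub>chang\<^esub> \<otimes>\<^bsub>chang\<^esub> a = a" by (simp add: one_chang mult_chang)
  have "(if x = \<zero> then (- k, \<zero>) else (- k - 1, \<sim> x)) \<in> carrier chang"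
    using a nontrivial neg_inject[of x \<zero>] by (simp add: carrier_chang)
  then show "\<exists>b\<in>carrier chang. b \<otimes>\<^bsub>chang\<^esub> a = \<one>\<^bsub>chang\<^esub>"
    using chang_l_inv[of x k] a by (auto simp: one_chang)
qed (use nontrivial in \<open>simp add: one_chang carrier_chang\<close>)

sublocale chang: comm_group chang
  by (rule comm_group_chang)

lemma inv_chang:
  assumes "x \<in> carrier A" "x \<noteq> \<sim> \<zero>"
  shows "inv\<^bsub>chang\<^esub> (k, x) = (if x = \<zero> then (- k, \<zero>) else (- k - 1, \<sim> x))"
  using assms chang_l_inv[of x k] nontrivial neg_inject[of x \<zero>]
  by (intro chang.inv_equality) (simp_all add: carrier_chang one_chang)

text \<open>The top element cannot be a remainder and becomes one full unit.\<close>

definition emb :: "'a \<Rightarrow> int \<times> 'a" where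
  "emb x = (if x = \<sim> \<zero> then (1, \<zero>) else (0, x))"

lemma emb_closed [simp]: "x \<in> carrier A \<Longrightarrow> emb x \<in> carrier chang"
  using nontrivial by (auto simp: emb_def carrier_chang)

lemma emb_zero: "emb \<zero> = \<one>\<^bsub>chang\<^esub>"
  using nontrivial by (auto simp: emb_def one_chang)

text \<open>By hypothesis the sum does not exceed one, so truncation loses nothing; a carry occurs
  only when the sum is exactly one, and it leaves remainder zero.\<close>

lemma emb_plus:
  assumes "\<sim> x \<oplus> \<sim> y = \<sim> \<zero>" and xy: "x \<in> carrier A" "y \<in> carrier A"
  shows "emb (x \<oplus> y) = emb x \<otimes>\<^bsub>chang\<^esub> emb y"
proof -
  have "y = \<zero>" if "x = \<sim> \<zero>" using that assms neg_inject[of y \<zero>] by simp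
  moreover have "x = \<zero>" if "y = \<sim> \<zero>" using that assms neg_inject[of x \<zero>] by simp
  ultimately show ?thesis using assms nontrivial by (auto simp: emb_def mult_chang)
qed

lemma emb_nonneg: "0 \<le> fst (emb x)"
  by (simp add: emb_def)

text \<open>Nonzero elements become strictly positive, which is what later keeps the values of
  elements below the top strictly below 1.\<close>

lemma inv_emb_nonneg_iff: "x \<in> carrier A \<Longrightarrow> 0 \<le> fst (inv\<^bsub>chang\<^esub> (emb x)) \<longleftrightarrow> x = \<zero>"
  using nontrivial by (auto simp: emb_def inv_chang)

end

text \<open>Each MV-relation among elements of \<open>J\<close> becomes, in Chang's group, a
  comparison of two-term sums; zero and one are adjoined to \<open>J\<close> to serve as the fixed
  terms.\<close>

lemma (in mv_chain) partial_embedding: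
  assumes J: "finite J" "J \<subseteq> carrier A"
  shows "\<exists>v :: 'a \<Rightarrow> real.
    (\<forall>a\<in>J. 0 \<le> v a \<and> v a \<le> 1 \<and> (v a = 1 \<longleftrightarrow> a = \<sim> \<zero>)) \<and>
    (\<forall>a\<in>J. \<sim> a \<in> J \<longrightarrow> v (\<sim> a) = 1 - v a) \<and>
    (\<forall>a\<in>J. \<forall>b\<in>J. a \<oplus> b \<in> J \<longrightarrow> v (a \<oplus> b) = min 1 (v a + v b))"
proof -
  let ?N = "\<lambda>g :: int \<times> 'a. 0 \<le> fst g" and ?J = "insert \<zero> (insert (\<sim> \<zero>) J)"
  have N_mult: "?N (g \<otimes>\<^bsub>chang\<^esub> h)" if "?N g" "?N h" for g h
    using that by (cases g; cases h) (simp add: mult_chang)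
  have N_total: "?N g \<or> ?N (inv\<^bsub>chang\<^esub> g)" if "g \<in> carrier chang" for g
    using that by (cases g) (auto simp: carrier_chang inv_chang)
  have J' [simp]: "x \<in> carrier A" if "x \<in> J" for x using J that by auto
  have "\<exists>x :: 'a \<Rightarrow> real. \<forall>a\<in>?J. \<forall>b\<in>?J. \<forall>c\<in>?J. \<forall>d\<in>?J.
      ?N ((emb a \<otimes>\<^bsub>chang\<^esub> emb b) \<otimes>\<^bsub>chang\<^esub> inv\<^bsub>chang\<^esub> (emb c \<otimes>\<^bsub>chang\<^esub> emb d)) \<longleftrightarrow>
      x c + x d \<le> x a + x b"
    by (rule chang.finite_order_representation) (use N_mult N_total J in auto)
  then obtain x :: "'a \<Rightarrow> real" where x: "\<And>a b c d. a \<in> ?J \<Longrightarrow> b \<in> ?J \<Longrightarrow> c \<in> ?J \<Longrightarrow> d \<in> ?J \<Longrightarrow>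
      ?N ((emb a \<otimes>\<^bsub>chang\<^esub> emb b) \<otimes>\<^bsub>chang\<^esub> inv\<^bsub>chang\<^esub> (emb c \<otimes>\<^bsub>chang\<^esub> emb d)) \<longleftrightarrow>
      x c + x d \<le> x a + x b"
    by blast
  \<comment> \<open>The sign of the difference \<open>g\<close> of two sums decides the comparison
    of their real values.\<close>
  have x_le: "x c + x d \<le> x a + x b \<longleftrightarrow> ?N g"
    if "a \<in> ?J" "b \<in> ?J" "c \<in> ?J" "d \<in> ?J" "g \<in> carrier chang"
      "emb a \<otimes>\<^bsub>chang\<^esub> emb b = g \<otimes>\<^bsub>chang\<^esub> (emb c \<otimes>\<^bsub>chang\<^esub> emb d)" for a b c d g
  proof -
    have "emb c \<in> carrier chang" "emb d \<in> carrier chang" using that by auto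
    then have "(g \<otimes>\<^bsub>chang\<^esub> (emb c \<otimes>\<^bsub>chang\<^esub> emb d)) \<otimes>\<^bsub>chang\<^esub> inv\<^bsub>chang\<^esub> (emb c \<otimes>\<^bsub>chang\<^esub> emb d) = g"
      using that(5) by (simp add: chang.m_assoc)
    then show ?thesis using x[of a b c d] that by simp
  qed
  have x_eq: "x a + x b = x c + x d"
    if "a \<in> ?J" "b \<in> ?J" "c \<in> ?J" "d \<in> ?J"
      "emb a \<otimes>\<^bsub>chang\<^esub> emb b = emb c \<otimes>\<^bsub>chang\<^esub> emb d" for a b c d
  proof -
    have "emb c \<in> carrier chang" "emb d \<in> carrier chang" using that by auto
    then show ?thesis
      using x_le[of a b c d "\<one>\<^bsub>chang\<^esub>"] x_le[of c d a b "\<one>\<^bsub>chang\<^esub>"] that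
        chang.one_closed by (simp add: one_chang)
  qed
  have emb_neg: "emb a \<otimes>\<^bsub>chang\<^esub> emb (\<sim> a) = emb (\<sim> \<zero>)" if "a \<in> carrier A" for a
    using emb_plus[of a "\<sim> a"] that by simp
  \<comment> \<open>Were the gap not positive, the negative of the unit would be nonnegative in the
    group.\<close>
  have "\<not> x \<zero> + x (\<sim> \<zero>) \<le> x \<zero> + x \<zero>"
    by (subst x_le[of _ _ _ _ "inv\<^bsub>chang\<^esub> (emb (\<sim> \<zero>))"])
      (use nontrivial in \<open>simp_all add: emb_zero inv_emb_nonneg_iff\<close>)
  then have pos: "0 < x (\<sim> \<zero>) - x \<zero>" by simp
  have lower: "x \<zero> \<le> x a" if "a \<in> J" for a
    using x_le[of \<zero> a \<zero> \<zero> "emb a"] that by (simp add: emb_zero emb_nonneg)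
  have upper: "x a \<le> x (\<sim> \<zero>)" if "a \<in> J" for a
    using x_le[of \<zero> "\<sim> \<zero>" \<zero> a "emb (\<sim> a)"] emb_neg[of a] that
    by (simp add: emb_zero emb_nonneg chang.m_comm)
  have top: "x (\<sim> \<zero>) \<le> x a \<longleftrightarrow> a = \<sim> \<zero>" if "a \<in> J" for a
  proof -
    \<comment> \<open>The excess of \<open>a\<close> over the unit is the negative of
      \<open>\<sim> a\<close>.\<close>
    have "emb a = inv\<^bsub>chang\<^esub> (emb (\<sim> a)) \<otimes>\<^bsub>chang\<^esub> emb (\<sim> \<zero>)"
      using that by (simp flip: emb_neg[of a] add: chang.m_comm[of "emb a"] chang.inv_solve_left)
    then show ?thesis
      using x_le[of \<zero> a \<zero> "\<sim> \<zero>" "inv\<^bsub>chang\<^esub> (emb (\<sim> a))"] that neg_inject[of a "\<sim> \<zero>"]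
      by (simp add: emb_zero inv_emb_nonneg_iff)
  qed
  have neg: "x a + x (\<sim> a) = x \<zero> + x (\<sim> \<zero>)" if "a \<in> J" "\<sim> a \<in> J" for a
    using x_eq[of a "\<sim> a" \<zero> "\<sim> \<zero>"] that by (simp add: emb_neg emb_zero)
  have plus: "x (a \<oplus> b) = x a + x b - x \<zero> \<or> a \<oplus> b = \<sim> \<zero> \<and> x \<zero> + x (\<sim> \<zero>) \<le> x a + x b"
    if ab: "a \<in> J" "b \<in> J" "a \<oplus> b \<in> J" for a b
  proof (cases "\<sim> a \<oplus> \<sim> b = \<sim> \<zero>")
    case True
    then show ?thesis
      using x_eq[of a b \<zero> "a \<oplus> b"] ab emb_plus[of a b] by (simp add: emb_zero)
  next
    case False
    then have one: "a \<oplus> b = \<sim> \<zero>" using plus_eq_one_cases[of a b] ab by auto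
    \<comment> \<open>The untruncated sum passes one, and \<open>?d\<close> is its surplus over the
      unit.\<close>
    let ?d = "b \<ominus> \<sim> a"
    have d: "?d \<oplus> \<sim> a = b" using one ab by (simp add: minus_plus_cancel mv_le_def)
    have "\<sim> ?d \<oplus> \<sim> (\<sim> a) = \<sim> \<zero>" using ab by (simp add: mv_minus_def flip: plus_assoc)
    then have "emb b = emb ?d \<otimes>\<^bsub>chang\<^esub> emb (\<sim> a)" using emb_plus[of ?d "\<sim> a"] ab d by simp
    then have "emb a \<otimes>\<^bsub>chang\<^esub> emb b = emb ?d \<otimes>\<^bsub>chang\<^esub> (emb \<zero> \<otimes>\<^bsub>chang\<^esub> emb (\<sim> \<zero>))"
      using ab by (simp flip: emb_neg[of a] add: emb_zero chang.m_lcomm)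
    then show ?thesis using x_le[of a b \<zero> "\<sim> \<zero>" "emb ?d"] ab one by (simp add: emb_nonneg)
  qed
  \<comment> \<open>Comparisons with two terms on each side are invariant under translation and
    positive scaling of \<open>x\<close>; the affine normalisation puts zero at 0 and the top at
    1.\<close>
  define v where "v a = (x a - x \<zero>) / (x (\<sim> \<zero>) - x \<zero>)" for a
  have "0 \<le> v a \<and> v a \<le> 1 \<and> (v a = 1 \<longleftrightarrow> a = \<sim> \<zero>)" if "a \<in> J" for a
    using pos lower[OF that] upper[OF that] top[OF that] by (auto simp: v_def)
  moreover have "v (\<sim> a) = 1 - v a" if "a \<in> J" "\<sim> a \<in> J" for a
    using pos neg[OF that] by (simp add: v_def field_simps)
  moreover have "v (a \<oplus> b) = min 1 (v a + v b)" if "a \<in> J" "b \<in> J" "a \<oplus> b \<in> J" for a b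
    using plus[OF that]
  proof
    assume *: "x (a \<oplus> b) = x a + x b - x \<zero>"
    then have "v (a \<oplus> b) = v a + v b" by (simp add: v_def add_divide_distrib[symmetric])
    moreover have "v (a \<oplus> b) \<le> 1" using pos upper[OF that(3)] by (simp add: v_def)
    ultimately show ?thesis by simp
  next
    assume "a \<oplus> b = \<sim> \<zero> \<and> x \<zero> + x (\<sim> \<zero>) \<le> x a + x b"
    then have "v (a \<oplus> b) = 1" "1 \<le> v a + v b"
      using pos by (auto simp: v_def add_divide_distrib[symmetric])
    then show ?thesis by simp
  qed
  ultimately show ?thesis by (intro exI[of _ v]) blast
qed

section \<open>The Lindenbaum algebra\<close>

lemma derives_trans:
  "luk_derives \<Phi> (Imp p q) \<Longrightarrow> luk_derives \<Phi> (Imp q r) \<Longrightarrow> luk_derives \<Phi> (Imp p r)"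
  by (meson ax2 mp)

lemma derives_suffixing:
  "luk_derives \<Phi> (Imp p q) \<Longrightarrow> luk_derives \<Phi> (Imp (Imp q r) (Imp p r))"
  by (meson ax2 mp)

text \<open>\<open>ax1\<close> with \<open>Imp q p\<close> as the inner antecedent yields exactly
  the premise of an instance of \<open>ax3\<close>.\<close>

lemma derives_assertion: "luk_derives \<Phi> (Imp p (Imp (Imp p q) q))"
  by (rule derives_trans[OF ax1 ax3])

text \<open>\<open>ax2\<close> produces the antecedent \<open>Imp (Imp q r) r\<close>, and assertion
  lets \<open>q\<close> stand in its place.\<close>

lemma derives_exchange: "luk_derives \<Phi> (Imp (Imp p (Imp q r)) (Imp q (Imp p r)))"
  by (rule derives_trans[OF ax2 derives_suffixing[OF derives_assertion]])

lemma derives_prefixing: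
  "luk_derives \<Phi> (Imp p q) \<Longrightarrow> luk_derives \<Phi> (Imp (Imp r p) (Imp r q))"
  by (meson ax2 mp derives_exchange)

lemma derives_refl: "luk_derives \<Phi> (Imp p p)"
  by (meson ax1 mp derives_exchange)

lemma derives_double_neg_elim: "luk_derives \<Phi> (Imp (Neg (Neg p)) p)"
proof -
  let ?t = "Imp p p"
  \<comment> \<open>Guarding by the double negation of the theorem \<open>?t\<close> makes both
    sides negations, so \<open>ax4\<close> applies twice and leaves a derivable antecedent.\<close>
  have "luk_derives \<Phi> (Imp (Neg (Neg p)) (Imp ?t p))"
    by (rule derives_trans[OF derives_trans[OF ax1 ax4] ax4])
  then show ?thesis by (meson mp derives_exchange derives_refl)
qed

lemma derives_double_neg_intro: "luk_derives \<Phi> (Imp p (Neg (Neg p)))"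
  by (rule mp[OF derives_double_neg_elim ax4])

lemma derives_contrapos: "luk_derives \<Phi> (Imp (Imp p q) (Imp (Neg q) (Neg p)))"
  by (rule derives_trans[OF derives_trans[OF derives_suffixing[OF derives_double_neg_elim]
        derives_prefixing[OF derives_double_neg_intro]] ax4])

lemma derives_neg_mono: "luk_derives \<Phi> (Imp p q) \<Longrightarrow> luk_derives \<Phi> (Imp (Neg q) (Neg p))"
  by (meson mp derives_contrapos)

lemma derives_ex_falso: "luk_derives \<Phi> (Imp (Neg p) (Imp p q))"
  by (rule derives_trans[OF ax1 ax4])

text \<open>\<open>Odot\<close> is the strong conjunction rather than the minimum, but it is
  derivable exactly when both of its factors are.\<close>

lemma derives_Iff_iff:
  "luk_derives \<Phi> (Iff p q) \<longleftrightarrow> luk_derives \<Phi> (Imp p q) \<and> luk_derives \<Phi> (Imp q p)"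
proof -
  have "luk_derives \<Phi> (Imp (Odot a b) a)" for a b
    unfolding Odot_def
    by (rule derives_trans[OF derives_neg_mono[OF derives_ex_falso] derives_double_neg_elim])
  moreover have "luk_derives \<Phi> (Imp (Odot a b) b)" for a b
    unfolding Odot_def
    by (rule derives_trans[OF derives_neg_mono[OF ax1] derives_double_neg_elim])
  moreover have "luk_derives \<Phi> (Odot a b)" if "luk_derives \<Phi> a" "luk_derives \<Phi> b" for a b
    unfolding Odot_def
    by (meson that mp derives_assertion derives_contrapos derives_double_neg_intro)
  ultimately show ?thesis unfolding Iff_def using mp by blast
qed

lemma derives_Imp_mono:
  assumes "luk_derives \<Phi> (Imp p' p)" "luk_derives \<Phi> (Imp q q')"
  shows "luk_derives \<Phi> (Imp (Imp p q) (Imp p' q'))"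
  by (rule derives_trans[OF derives_suffixing[OF assms(1)] derives_prefixing[OF assms(2)]])

lemma derives_Oplus_commute: "luk_derives \<Phi> (Imp (Oplus p q) (Oplus q p))"
  unfolding Oplus_def
  by (rule derives_trans[OF derives_contrapos derives_prefixing[OF derives_double_neg_elim]])

lemma derives_Oplus_mono:
  assumes "luk_derives \<Phi> (Imp p p')" "luk_derives \<Phi> (Imp q q')"
  shows "luk_derives \<Phi> (Imp (Oplus p q) (Oplus p' q'))"
  unfolding Oplus_def by (rule derives_Imp_mono[OF derives_neg_mono[OF assms(1)] assms(2)])

text \<open>\<open>Oplus p (Oplus r q)\<close> is an implication with antecedents
  \<open>Neg p\<close> and \<open>Neg r\<close>, so exchange and commutativity together give
  associativity.\<close>

lemma derives_Oplus_assoc: "luk_derives \<Phi> (Imp (Oplus p (Oplus q r)) (Oplus (Oplus p q) r))"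
proof -
  have "luk_derives \<Phi> (Imp (Oplus p (Oplus q r)) (Oplus p (Oplus r q)))"
    by (rule derives_Oplus_mono[OF derives_refl derives_Oplus_commute])
  moreover have "luk_derives \<Phi> (Imp (Oplus p (Oplus r q)) (Oplus r (Oplus p q)))"
    unfolding Oplus_def by (rule derives_exchange)
  ultimately show ?thesis by (meson derives_trans derives_Oplus_commute)
qed

lemma derives_Oplus_assoc': "luk_derives \<Phi> (Imp (Oplus (Oplus p q) r) (Oplus p (Oplus q r)))"
proof -
  have "luk_derives \<Phi> (Imp (Oplus p (Oplus r q)) (Oplus p (Oplus q r)))"
    by (rule derives_Oplus_mono[OF derives_refl derives_Oplus_commute])
  moreover have "luk_derives \<Phi> (Imp (Oplus r (Oplus p q)) (Oplus p (Oplus r q)))"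
    unfolding Oplus_def by (rule derives_exchange)
  ultimately show ?thesis by (meson derives_trans derives_Oplus_commute)
qed

lemma derives_Oplus_falsum: "luk_derives \<Phi> (Imp (Oplus p (Neg (Imp q q))) p)"
  unfolding Oplus_def
  by (rule derives_trans[OF ax4]) (meson derives_assertion derives_refl mp)

lemma derives_Oplus_intro: "luk_derives \<Phi> (Imp p (Oplus p q))"
  unfolding Oplus_def by (rule derives_trans[OF derives_double_neg_intro derives_ex_falso])

abbreviation Bot :: form where "Bot \<equiv> Neg (Imp (Var 1) (Var 1))"

lemma derives_Oplus_Top: "luk_derives \<Phi> (Oplus p (Neg Bot))"
  unfolding Oplus_def by (meson ax1 mp derives_refl derives_double_neg_intro)

text \<open>Up to double negations each side is the iterated implication that expresses the maximum,
  and \<open>ax3\<close> is its symmetry.\<close>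

lemma derives_luk:
  "luk_derives \<Phi> (Imp (Oplus (Neg (Oplus (Neg p) q)) q) (Oplus (Neg (Oplus (Neg q) p)) p))"
proof -
  have to: "luk_derives \<Phi> (Imp (Oplus (Neg (Oplus (Neg p) q)) q) (Imp (Imp p q) q))" for p q
    unfolding Oplus_def
    by (rule derives_suffixing[OF derives_trans[OF derives_suffixing[OF derives_double_neg_elim]
          derives_double_neg_intro]])
  have "luk_derives \<Phi> (Imp (Imp (Imp p q) q) (Oplus (Neg (Oplus (Neg p) q)) q))" for p q
    unfolding Oplus_def
    by (rule derives_suffixing[OF derives_trans[OF derives_double_neg_elim
          derives_suffixing[OF derives_double_neg_intro]]])
  with to show ?thesis by (meson derives_trans ax3)
qed

lemma FORM_simps [simp]:
  "Neg p \<in> FORM n \<longleftrightarrow> p \<in> FORM n"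
  "Imp p q \<in> FORM n \<longleftrightarrow> p \<in> FORM n \<and> q \<in> FORM n"
  "Oplus p q \<in> FORM n \<longleftrightarrow> p \<in> FORM n \<and> q \<in> FORM n"
  "Var i \<in> FORM n \<longleftrightarrow> 1 \<le> i \<and> i \<le> n"
  by (auto simp: FORM_def Oplus_def)

lemma lind_equiv_iff:
  "(p, q) \<in> lind_equiv n \<Phi> \<longleftrightarrow>
    p \<in> FORM n \<and> q \<in> FORM n \<and> luk_derives \<Phi> (Imp p q) \<and> luk_derives \<Phi> (Imp q p)"
  by (simp add: lind_equiv_def derives_Iff_iff)

lemma equiv_lind: "equiv (FORM n) (lind_equiv n \<Phi>)"
proof (rule equivI)
  show "lind_equiv n \<Phi> \<subseteq> FORM n \<times> FORM n" by (auto simp: lind_equiv_def)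
  show "refl_on (FORM n) (lind_equiv n \<Phi>)"
    by (auto simp: refl_on_def lind_equiv_iff derives_refl)
  show "sym (lind_equiv n \<Phi>)" by (auto simp: sym_def lind_equiv_iff)
  show "trans (lind_equiv n \<Phi>)"
    by (auto simp: trans_def lind_equiv_iff intro: derives_trans)
qed

context
  fixes n :: nat and \<Phi> :: "form set"
begin

abbreviation lind_class ("\<lblot>_\<rblot>") where "\<lblot>p\<rblot> \<equiv> lind_equiv n \<Phi> `` {p}"

lemma lind_class_eq_iff:
  "p \<in> FORM n \<Longrightarrow> q \<in> FORM n \<Longrightarrow>
    \<lblot>p\<rblot> = \<lblot>q\<rblot> \<longleftrightarrow> luk_derives \<Phi> (Imp p q) \<and> luk_derives \<Phi> (Imp q p)"
  by (simp add: eq_equiv_class_iff[OF equiv_lind] lind_equiv_iff)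

lemma LIND_carrier: "carrier (LIND n \<Phi>) = (\<lambda>p. \<lblot>p\<rblot>) ` FORM n"
  by (auto simp: LIND_def quotient_def)

lemma LIND_zero: "mv_zero (LIND n \<Phi>) = \<lblot>Bot\<rblot>"
  by (simp add: LIND_def)

lemma LIND_neg:
  assumes "p \<in> FORM n" shows "mv_neg (LIND n \<Phi>) \<lblot>p\<rblot> = \<lblot>Neg p\<rblot>"
proof -
  have "(\<lambda>p. \<lblot>Neg p\<rblot>) respects lind_equiv n \<Phi>"
    by (rule congruentI) (simp add: lind_equiv_iff lind_class_eq_iff derives_neg_mono)
  then show ?thesis using assms by (simp add: LIND_def UN_equiv_class[OF equiv_lind])
qed

lemma LIND_plus:
  assumes "p \<in> FORM n" "q \<in> FORM n"
  shows "mv_plus (LIND n \<Phi>) \<lblot>p\<rblot> \<lblot>q\<rblot> = \<lblot>Oplus p q\<rblot>"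
proof -
  have "(\<lambda>p q. \<lblot>Oplus p q\<rblot>) respects2 lind_equiv n \<Phi>"
    by (rule congruent2I') (simp add: lind_equiv_iff lind_class_eq_iff derives_Oplus_mono)
  then show ?thesis using assms
    by (simp add: LIND_def UN_equiv_class2[OF equiv_lind equiv_lind])
qed

lemmas LIND_simps = LIND_carrier LIND_zero LIND_neg LIND_plus

lemma LIND_mv_algebra:
  assumes "n \<ge> 1"
  shows "mv_algebra (LIND n \<Phi>)"
proof
  fix X Y Z assume "X \<in> carrier (LIND n \<Phi>)" "Y \<in> carrier (LIND n \<Phi>)" "Z \<in> carrier (LIND n \<Phi>)"
  then obtain p q r where "p \<in> FORM n" "X = \<lblot>p\<rblot>" "q \<in> FORM n" "Y = \<lblot>q\<rblot>" "r \<in> FORM n" "Z = \<lblot>r\<rblot>"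
    by (auto simp: LIND_carrier)
  then show "X \<oplus>\<^bsub>LIND n \<Phi>\<^esub> (Y \<oplus>\<^bsub>LIND n \<Phi>\<^esub> Z) = X \<oplus>\<^bsub>LIND n \<Phi>\<^esub> Y \<oplus>\<^bsub>LIND n \<Phi>\<^esub> Z"
    by (simp add: LIND_plus lind_class_eq_iff derives_Oplus_assoc derives_Oplus_assoc')
next
  fix X Y assume "X \<in> carrier (LIND n \<Phi>)" "Y \<in> carrier (LIND n \<Phi>)"
  then obtain p q where *: "p \<in> FORM n" "X = \<lblot>p\<rblot>" "q \<in> FORM n" "Y = \<lblot>q\<rblot>"
    by (auto simp: LIND_carrier)
  show "X \<oplus>\<^bsub>LIND n \<Phi>\<^esub> Y \<in> carrier (LIND n \<Phi>)" "\<sim>\<^bsub>LIND n \<Phi>\<^esub> X \<in> carrier (LIND n \<Phi>)"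
    using * by (auto simp: LIND_simps)
  show "X \<oplus>\<^bsub>LIND n \<Phi>\<^esub> Y = Y \<oplus>\<^bsub>LIND n \<Phi>\<^esub> X"
    using * by (simp add: LIND_plus lind_class_eq_iff derives_Oplus_commute)
  show "\<sim>\<^bsub>LIND n \<Phi>\<^esub> (\<sim>\<^bsub>LIND n \<Phi>\<^esub> X \<oplus>\<^bsub>LIND n \<Phi>\<^esub> Y) \<oplus>\<^bsub>LIND n \<Phi>\<^esub> Y =
      \<sim>\<^bsub>LIND n \<Phi>\<^esub> (\<sim>\<^bsub>LIND n \<Phi>\<^esub> Y \<oplus>\<^bsub>LIND n \<Phi>\<^esub> X) \<oplus>\<^bsub>LIND n \<Phi>\<^esub> X"
    using * by (simp add: LIND_plus LIND_neg lind_class_eq_iff derives_luk)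
  have "luk_derives \<Phi> (Neg Bot)" by (meson mp derives_refl derives_double_neg_intro)
  then show "X \<oplus>\<^bsub>LIND n \<Phi>\<^esub> \<sim>\<^bsub>LIND n \<Phi>\<^esub> \<zero>\<^bsub>LIND n \<Phi>\<^esub> = \<sim>\<^bsub>LIND n \<Phi>\<^esub> \<zero>\<^bsub>LIND n \<Phi>\<^esub>"
    using * assms derives_Oplus_Top[of \<Phi> p]
    by (simp add: LIND_plus LIND_neg LIND_zero lind_class_eq_iff) (meson ax1 mp)
  show "X \<oplus>\<^bsub>LIND n \<Phi>\<^esub> \<zero>\<^bsub>LIND n \<Phi>\<^esub> = X"
    using * assms by (simp add: LIND_plus LIND_zero lind_class_eq_iff derives_Oplus_falsum derives_Oplus_intro)
  show "\<sim>\<^bsub>LIND n \<Phi>\<^esub> (\<sim>\<^bsub>LIND n \<Phi>\<^esub> X) = X"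
    using * by (simp add: LIND_neg lind_class_eq_iff derives_double_neg_elim derives_double_neg_intro)
qed (use assms in \<open>auto simp: LIND_carrier LIND_zero\<close>)

end

section \<open>Soundness of the real-valued semantics\<close>

primrec luk_val :: "(nat \<Rightarrow> real) \<Rightarrow> form \<Rightarrow> real" where
  "luk_val v (Var i) = v i"
| "luk_val v (Neg p) = 1 - luk_val v p"
| "luk_val v (Imp p q) = min 1 (1 - luk_val v p + luk_val v q)"

lemma luk_val_bounds:
  assumes "\<And>i. 0 \<le> v i" "\<And>i. v i \<le> 1"
  shows "0 \<le> luk_val v p" "luk_val v p \<le> 1"
  using assms by (induction p) auto

lemma luk_val_sound:
  assumes "luk_derives \<Phi> p" and v: "\<And>i. 0 \<le> v i" "\<And>i. v i \<le> 1"
    and "\<And>q. q \<in> \<Phi> \<Longrightarrow> luk_val v q = 1"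
  shows "luk_val v p = 1"
  using assms(1)
proof induction
  case (ax1 p q)
  then show ?case using luk_val_bounds[of v p, OF v] luk_val_bounds[of v q, OF v] by simp
next
  case (ax2 p q r)
  then show ?case using luk_val_bounds[of v p, OF v] luk_val_bounds[of v q, OF v]
      luk_val_bounds[of v r, OF v] by (simp add: min_def)
next
  case (ax3 p q)
  then show ?case using luk_val_bounds[of v p, OF v] luk_val_bounds[of v q, OF v] by (simp add: min_def)
next
  case (mp p q)
  then show ?case using luk_val_bounds(2)[of v q, OF v] by simp
qed (simp_all add: assms)

section \<open>Valuations in the unit interval\<close>

primrec mv_eval :: "('a, 'b) mv_struct_scheme \<Rightarrow> (nat \<Rightarrow> 'a) \<Rightarrow> form \<Rightarrow> 'a" where
  "mv_eval A s (Var i) = s i"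
| "mv_eval A s (Neg p) = \<sim>\<^bsub>A\<^esub> (mv_eval A s p)"
| "mv_eval A s (Imp p q) = \<sim>\<^bsub>A\<^esub> (mv_eval A s p) \<oplus>\<^bsub>A\<^esub> mv_eval A s q"

primrec subforms :: "form \<Rightarrow> form set" where
  "subforms (Var i) = {Var i}"
| "subforms (Neg p) = insert (Neg p) (subforms p)"
| "subforms (Imp p q) = insert (Imp p q) (subforms p \<union> subforms q)"

lemma finite_subforms: "finite (subforms p)"
  by (induction p) auto

lemma subforms_self: "p \<in> subforms p"
  by (cases p) auto

lemma subforms_closed:
  "Neg q \<in> subforms p \<Longrightarrow> q \<in> subforms p"
  "Imp q r \<in> subforms p \<Longrightarrow> q \<in> subforms p \<and> r \<in> subforms p"
  by (induction p) (auto simp: subforms_self)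

lemma (in mv_algebra) mv_eval_closed:
  "(\<And>i. s i \<in> carrier A) \<Longrightarrow> mv_eval A s p \<in> carrier A"
  by (induction p) auto

lemma (in mv_chain) exists_valuation:
  assumes F: "finite F" and s: "\<And>i. s i \<in> carrier A"
  shows "\<exists>v. (\<forall>i. 0 \<le> v i \<and> v i \<le> 1) \<and>
    (\<forall>p\<in>F. luk_val v p = 1 \<longleftrightarrow> mv_eval A s p = \<sim> \<zero>)"
proof -
  define K where "K = (\<Union>p\<in>F. subforms p)"
  \<comment> \<open>An implication evaluates as a negation followed by \<oplus>, so the negated
    values have to belong to the finite part as well.\<close>
  define J where "J = mv_eval A s ` K \<union> mv_neg A ` mv_eval A s ` K"
  have "finite J" using F finite_subforms by (simp add: J_def K_def)
  moreover have "J \<subseteq> carrier A" using mv_eval_closed[OF s] by (auto simp: J_def)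
  ultimately obtain x :: "'a \<Rightarrow> real" where
    x1: "\<And>a. a \<in> J \<Longrightarrow> 0 \<le> x a \<and> x a \<le> 1 \<and> (x a = 1 \<longleftrightarrow> a = \<sim> \<zero>)"
    and x2: "\<And>a. a \<in> J \<Longrightarrow> \<sim> a \<in> J \<Longrightarrow> x (\<sim> a) = 1 - x a"
    and x3: "\<And>a b. a \<in> J \<Longrightarrow> b \<in> J \<Longrightarrow> a \<oplus> b \<in> J \<Longrightarrow> x (a \<oplus> b) = min 1 (x a + x b)"
    using partial_embedding[of J] by blast
  \<comment> \<open>Variables outside \<open>K\<close> do not occur in \<open>F\<close>; the value 0
    keeps the valuation inside the unit interval.\<close>
  define v where "v i = (if Var i \<in> K then x (s i) else 0)" for i
  have inJ: "mv_eval A s p \<in> J" "\<sim> (mv_eval A s p) \<in> J" if "p \<in> K" for p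
    using that by (auto simp: J_def)
  have val: "luk_val v p = x (mv_eval A s p)" if "p \<in> K" for p
    using that
  proof (induction p)
    case (Neg p)
    then have "p \<in> K" using subforms_closed(1) by (auto simp: K_def)
    then show ?case using Neg inJ by (simp add: x2)
  next
    case (Imp p q)
    then have "p \<in> K" "q \<in> K" using subforms_closed(2) unfolding K_def by blast+
    then show ?case using Imp inJ inJ(1)[of "Imp p q"] by (simp add: x2 x3)
  qed (simp add: v_def)
  have "0 \<le> v i \<and> v i \<le> 1" for i
    using x1[of "s i"] inJ(1)[of "Var i"] by (simp add: v_def)
  moreover have "luk_val v p = 1 \<longleftrightarrow> mv_eval A s p = \<sim> \<zero>" if "p \<in> F" for p
  proof -
    have "p \<in> K" using that subforms_self by (auto simp: K_def)
    then show ?thesis using x1 inJ by (simp add: val)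
  qed
  ultimately show ?thesis by blast
qed

text \<open>The prime ideal avoids the negation of the value of \<open>p\<close>, so this value
  stays different from one in the chain quotient, while the values equal to one are preserved. The
  finite set \<open>insert p F\<close> is then transported to the reals.\<close>

lemma (in mv_algebra) exists_separating_valuation:
  assumes F: "finite F" and s: "\<And>i. s i \<in> carrier A"
    and one: "\<And>q. q \<in> F \<Longrightarrow> mv_eval A s q = \<sim> \<zero>" and p: "mv_eval A s p \<noteq> \<sim> \<zero>"
  obtains v where "\<And>i. 0 \<le> v i" "\<And>i. v i \<le> 1" "\<And>q. q \<in> F \<Longrightarrow> luk_val v q = 1" "luk_val v p \<noteq> 1"
proof -
  have closed: "mv_eval A s q \<in> carrier A" for q using s by (rule mv_eval_closed)
  have "\<sim> (mv_eval A s p) \<noteq> \<zero>" using p closed neg_neg by metis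
  then obtain P where P: "prime_ideal P" "\<sim> (mv_eval A s p) \<notin> P"
    using exists_prime_ideal closed neg_closed by blast
  then have I: "mv_ideal A P" by (simp add: prime_ideal_def)
  interpret Q: mv_chain "mv_quotient A P" using quotient_prime_chain[OF P(1)] .
  define s' where "s' i = \<lbrakk>s i\<rbrakk>\<^bsub>P\<^esub>" for i
  have ev: "mv_eval (mv_quotient A P) s' q = \<lbrakk>mv_eval A s q\<rbrakk>\<^bsub>P\<^esub>" for q
    by (induction q) (simp_all add: s'_def quotient_simps[OF I] closed)
  have "\<exists>v. (\<forall>i. 0 \<le> v i \<and> v i \<le> 1) \<and> (\<forall>q\<in>insert p F. luk_val v q = 1 \<longleftrightarrow>
      mv_eval (mv_quotient A P) s' q = \<sim>\<^bsub>mv_quotient A P\<^esub> \<zero>\<^bsub>mv_quotient A P\<^esub>)"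
    using F s by (intro Q.exists_valuation) (auto simp: s'_def quotient_carrier[OF I])
  then obtain v where v: "\<And>i. 0 \<le> v i" "\<And>i. v i \<le> 1" "\<And>q. q \<in> insert p F \<Longrightarrow> luk_val v q = 1 \<longleftrightarrow>
      mv_eval (mv_quotient A P) s' q = \<sim>\<^bsub>mv_quotient A P\<^esub> \<zero>\<^bsub>mv_quotient A P\<^esub>"
    by blast
  have "luk_val v q = 1" if "q \<in> F" for q
    using v(3)[of q] that one by (simp add: ev quotient_simps[OF I])
  moreover have "luk_val v p \<noteq> 1"
  proof
    assume "luk_val v p = 1"
    then have "\<lbrakk>mv_eval A s p\<rbrakk>\<^bsub>P\<^esub> = \<lbrakk>\<sim> \<zero>\<rbrakk>\<^bsub>P\<^esub>" using v(3)[of p] by (simp add: ev quotient_simps[OF I])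
    then have "\<sim> \<zero> \<ominus> mv_eval A s p \<in> P" using coset_eq_iff[OF I] closed by simp
    then show False using P(2) closed by (simp add: mv_minus_def)
  qed
  ultimately show thesis using that v by blast
qed

section \<open>Real-valued homomorphisms and maximal ideals\<close>

definition mv_real_hom :: "('a, 'b) mv_struct_scheme \<Rightarrow> ('a \<Rightarrow> real) \<Rightarrow> bool" where
  "mv_real_hom A h \<longleftrightarrow> h \<zero>\<^bsub>A\<^esub> = 0 \<and> (\<forall>x\<in>carrier A. 0 \<le> h x \<and> h (\<sim>\<^bsub>A\<^esub> x) = 1 - h x) \<and>
    (\<forall>x\<in>carrier A. \<forall>y\<in>carrier A. h (x \<oplus>\<^bsub>A\<^esub> y) = min 1 (h x + h y))"

context mv_algebra
begin

context
  fixes h assumes h: "mv_real_hom A h"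
begin

lemma hom_zero [simp]: "h \<zero> = 0"
  and hom_neg [simp]: "x \<in> carrier A \<Longrightarrow> h (\<sim> x) = 1 - h x"
  and hom_plus [simp]: "x \<in> carrier A \<Longrightarrow> y \<in> carrier A \<Longrightarrow> h (x \<oplus> y) = min 1 (h x + h y)"
  and hom_nonneg: "x \<in> carrier A \<Longrightarrow> 0 \<le> h x"
  using h by (auto simp: mv_real_hom_def)

lemma hom_mono:
  assumes "x \<preceq> y" "x \<in> carrier A" "y \<in> carrier A" shows "h x \<le> h y"
proof -
  have "h (\<sim> x \<oplus> y) = 1" using assms by (simp add: mv_le_def del: hom_plus)
  then show ?thesis using assms by simp
qed

lemma kernel_ideal: "mv_ideal A {x \<in> carrier A. h x = 0}"
proof -
  have "h y = 0" if "h x = 0" "y \<preceq> x" "x \<in> carrier A" "y \<in> carrier A" for x y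
    using hom_mono[of y x] hom_nonneg[of y] that by simp
  then show ?thesis by (auto simp: mv_ideal_def)
qed

text \<open>By the Archimedean property some multiple of an element outside the kernel has value
  one. Its negation is then in the kernel, and an ideal containing both is the whole
  algebra.\<close>

lemma kernel_maximal: "mv_maximal_ideal A {x \<in> carrier A. h x = 0}"
  unfolding mv_maximal_ideal_def
proof (intro conjI allI impI)
  show "mv_ideal A {x \<in> carrier A. h x = 0}" by (rule kernel_ideal)
  have "h (\<sim> \<zero>) \<noteq> 0" by simp
  then show "{x \<in> carrier A. h x = 0} \<noteq> carrier A" using neg_closed[OF zero_closed] by blast
next
  fix J assume J: "mv_ideal A J \<and> {x \<in> carrier A. h x = 0} \<subseteq> J"
  show "J = {x \<in> carrier A. h x = 0} \<or> J = carrier A"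
  proof (rule disjCI)
    assume "J \<noteq> carrier A"
    have "h x = 0" if "x \<in> J" for x
    proof (rule ccontr)
      assume "h x \<noteq> 0"
      have x: "x \<in> carrier A" using that J ideal_subset by blast
      then have "0 < h x" using hom_nonneg[of x] \<open>h x \<noteq> 0\<close> by simp
      then obtain k :: nat where k: "1 < real k * h x" using reals_Archimedean3 by blast
      have "h (times l x) = min 1 (real l * h x)" for l
        using x hom_nonneg[of x] by (induction l) (auto simp: min_def algebra_simps)
      then have "h (\<sim> (times k x)) = 0" using k x by simp
      moreover have "times l x \<in> J" for l
        using J that by (induction l) (auto intro: ideal_zero ideal_plus)
      ultimately have "times k x \<oplus> \<sim> (times k x) \<in> J"
        using J x by (intro ideal_plus) auto
      then have "carrier A \<subseteq> J" using J x ideal_down[of J "\<sim> \<zero>"] by auto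
      then show False using \<open>J \<noteq> carrier A\<close> J ideal_subset by blast
    qed
    then show "J = {x \<in> carrier A. h x = 0}" using J ideal_subset by blast
  qed
qed

text \<open>Vanishing on \<open>I\<close> makes \<open>h\<close> monotone modulo \<open>I\<close>,
  so its value at a coset does not depend on the chosen representative.\<close>

lemma quotient_hom:
  assumes I: "mv_ideal A I" and ker: "\<And>x. x \<in> I \<Longrightarrow> h x = 0"
  obtains h' where "mv_real_hom (mv_quotient A I) h'" "\<And>x. x \<in> carrier A \<Longrightarrow> h' \<lbrakk>x\<rbrakk>\<^bsub>I\<^esub> = h x"
proof -
  define h' where "h' X = h (SOME x. x \<in> X)" for X
  have le: "h x \<le> h y" if "x \<ominus> y \<in> I" "x \<in> carrier A" "y \<in> carrier A" for x y
    using ker[OF that(1)] that(2,3) by (simp add: mv_minus_def)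
  have h': "h' \<lbrakk>x\<rbrakk>\<^bsub>I\<^esub> = h x" if x: "x \<in> carrier A" for x
  proof -
    have "x \<in> \<lbrakk>x\<rbrakk>\<^bsub>I\<^esub>" using equiv_class_self[OF equiv_cong[OF I] x] .
    then have "(x, SOME y. y \<in> \<lbrakk>x\<rbrakk>\<^bsub>I\<^esub>) \<in> mv_cong A I" by (metis Image_singleton_iff someI)
    then show ?thesis unfolding h'_def cong_iff[OF I] by (intro order_antisym le) auto
  qed
  then have "mv_real_hom (mv_quotient A I) h'"
    by (auto simp: mv_real_hom_def quotient_simps[OF I] hom_nonneg)
  then show thesis using that h' by blast
qed

end

lemma semisimpleI:
  assumes "\<And>b. b \<in> carrier A \<Longrightarrow> b \<noteq> \<zero> \<Longrightarrow> \<exists>h. mv_real_hom A h \<and> h b \<noteq> 0"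
  shows "mv_semisimple A"
proof -
  have "b = \<zero>" if b: "b \<in> carrier A" "\<forall>M. mv_maximal_ideal A M \<longrightarrow> b \<in> M" for b
  proof (rule ccontr)
    assume "b \<noteq> \<zero>"
    then obtain h where h: "mv_real_hom A h" "h b \<noteq> 0" using assms b by blast
    then show False using kernel_maximal[OF h(1)] b(2) by blast
  qed
  moreover have "\<zero> \<in> M" if "mv_maximal_ideal A M" for M
    using that ideal_zero by (simp add: mv_maximal_ideal_def)
  ultimately show ?thesis
    unfolding mv_semisimple_def using mv_algebra_axioms by auto
qed

lemma ideal_gen:
  assumes "a \<in> carrier A"
  shows "mv_ideal A (mv_ideal_gen A a)" "a \<in> mv_ideal_gen A a"
    "mv_ideal A I \<Longrightarrow> a \<in> I \<Longrightarrow> mv_ideal_gen A a \<subseteq> I"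
proof -
  \<comment> \<open>The intersected family is therefore nonempty, and the intersection stays inside
    the carrier.\<close>
  have "mv_ideal A (carrier A)" by (simp add: mv_ideal_def)
  then show "mv_ideal A (mv_ideal_gen A a)"
    using assms unfolding mv_ideal_def mv_ideal_gen_def by blast
qed (auto simp: mv_ideal_gen_def)

end

text \<open>Soundness makes the valuation monotone along implications derivable from \<Phi>, hence
  constant on the classes.\<close>

lemma LIND_hom:
  assumes "n \<ge> 1" and v: "\<And>i. 0 \<le> v i" "\<And>i. v i \<le> 1" and \<Phi>: "\<And>q. q \<in> \<Phi> \<Longrightarrow> luk_val v q = 1"
  obtains h where "mv_real_hom (LIND n \<Phi>) h" "\<And>p. p \<in> FORM n \<Longrightarrow> h (lind_class n \<Phi> p) = luk_val v p"
proof -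
  define h where "h X = luk_val v (SOME p. p \<in> X)" for X
  have le: "luk_val v p \<le> luk_val v q" if "luk_derives \<Phi> (Imp p q)" for p q
    using luk_val_sound[of \<Phi> "Imp p q" v, OF that v \<Phi>] by simp
  have h: "h (lind_class n \<Phi> p) = luk_val v p" if p: "p \<in> FORM n" for p
  proof -
    have "p \<in> lind_class n \<Phi> p" using equiv_class_self[OF equiv_lind p] .
    then have "(p, SOME q. q \<in> lind_class n \<Phi> p) \<in> lind_equiv n \<Phi>" by (metis Image_singleton_iff someI)
    then show ?thesis unfolding h_def lind_equiv_iff by (intro order_antisym le) auto
  qed
  have "mv_real_hom (LIND n \<Phi>) h"
    using assms luk_val_bounds[of v, OF v]
    by (auto simp: mv_real_hom_def LIND_simps h) (simp_all add: Oplus_def)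
  then show thesis using that h by blast
qed

theorem theorem4p4:
  fixes n :: nat and \<Phi> :: "form set"
  assumes "n \<ge> 1" and "finite \<Phi>" and "\<Phi> \<subseteq> FORM n"
  shows "mv_strongly_semisimple (LIND n \<Phi>)"
proof -
  interpret L: mv_algebra "LIND n \<Phi>" by (rule LIND_mv_algebra[OF assms(1)])
  let ?c = "lind_class n \<Phi>"
  have "mv_semisimple (mv_quotient (LIND n \<Phi>) I)" if principal: "mv_principal_ideal (LIND n \<Phi>) I" for I
  proof -
    obtain a where a: "a \<in> FORM n" and I_gen: "I = mv_ideal_gen (LIND n \<Phi>) (?c a)"
      using principal unfolding mv_principal_ideal_def LIND_carrier by blast
    have ca: "?c p \<in> carrier (LIND n \<Phi>)" if "p \<in> FORM n" for p using that by (simp add: LIND_carrier)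
    have I: "mv_ideal (LIND n \<Phi>) I" and aI: "?c a \<in> I"
      unfolding I_gen using L.ideal_gen[OF ca[OF a]] by auto
    define B where "B = mv_quotient (LIND n \<Phi>) I"
    interpret B: mv_algebra B unfolding B_def by (rule L.quotient_mv_algebra[OF I])
    define d where "d p = L.coset (?c p) I" for p
    \<comment> \<open>Zero fills in for the indices outside the range, which no formula of
      \<open>FORM n\<close> mentions, and keeps \<open>s\<close> in the carrier.\<close>
    define s where "s i = (if 1 \<le> i \<and> i \<le> n then d (Var i) else \<zero>\<^bsub>B\<^esub>)" for i
    note B_simps = B_def L.quotient_simps[OF I] LIND_neg LIND_plus ca
    have d_neg: "\<sim>\<^bsub>B\<^esub> (d p) = d (Neg p)" if "p \<in> FORM n" for p
      using that by (simp add: d_def B_simps)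
    have d_plus: "d p \<oplus>\<^bsub>B\<^esub> d q = d (Oplus p q)" if "p \<in> FORM n" "q \<in> FORM n" for p q
      using that by (simp add: d_def B_simps)
    have d_zero: "\<zero>\<^bsub>B\<^esub> = d Bot" by (simp add: d_def B_simps LIND_zero)
    have d_derives: "d p = d q"
      if "luk_derives \<Phi> (Imp p q)" "luk_derives \<Phi> (Imp q p)" "p \<in> FORM n" "q \<in> FORM n" for p q
      using that lind_class_eq_iff[of p n q \<Phi>] by (simp add: d_def)
    have "d p \<in> carrier B" if "p \<in> FORM n" for p using that by (simp add: d_def B_simps)
    then have s: "s i \<in> carrier B" for i by (simp add: s_def)
    \<comment> \<open>\<open>mv_eval\<close> reads an implication through negation and \<oplus>; in
      the Lindenbaum algebra this agrees with \<open>Imp\<close> up to a double negation.\<close>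
    have ev: "mv_eval B s p = d p" if "p \<in> FORM n" for p
      using that
    proof (induction p)
      case (Imp p q)
      have "luk_derives \<Phi> (Imp (Oplus (Neg p) q) (Imp p q))"
        "luk_derives \<Phi> (Imp (Imp p q) (Oplus (Neg p) q))"
        unfolding Oplus_def
        by (rule derives_suffixing derives_double_neg_intro derives_double_neg_elim)+
      then show ?case using Imp d_derives[of "Oplus (Neg p) q" "Imp p q"] by (simp add: d_neg d_plus)
    qed (simp_all add: d_neg s_def)
    have one: "d p = \<sim>\<^bsub>B\<^esub> \<zero>\<^bsub>B\<^esub>" if "p \<in> \<Phi>" for p
    proof -
      have "p \<in> FORM n" using that assms by auto
      moreover have "luk_derives \<Phi> (Imp (Neg Bot) p)" using hyp[OF that] ax1 mp by blast
      moreover have "luk_derives \<Phi> (Imp p (Neg Bot))"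
        using derives_refl derives_double_neg_intro ax1 mp by meson
      ultimately have "d p = d (Neg Bot)" using assms(1) by (intro d_derives) auto
      then show ?thesis using assms(1) by (simp add: d_zero d_neg)
    qed
    have "\<exists>h. mv_real_hom B h \<and> h b \<noteq> 0" if b: "b \<in> carrier B" "b \<noteq> \<zero>\<^bsub>B\<^esub>" for b
    proof -
      obtain p where p: "p \<in> FORM n" "b = d p"
        using b by (auto simp: B_def L.quotient_carrier[OF I] LIND_carrier d_def)
      \<comment> \<open>The generator vanishes in the quotient, so its negation joins \<Phi> as a
        formula of value one.\<close>
      have "d a = \<zero>\<^bsub>B\<^esub>"
        using aI L.coset_eq_zero_iff[OF I ca[OF a]] by (simp add: d_def B_def L.quotient_zero[OF I])
      then have "mv_eval B s q = \<sim>\<^bsub>B\<^esub> \<zero>\<^bsub>B\<^esub>" if "q \<in> insert (Neg a) \<Phi>" for q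
        using that a assms(3) one by (auto simp: ev d_neg[symmetric])
      moreover have "mv_eval B s (Neg p) \<noteq> \<sim>\<^bsub>B\<^esub> \<zero>\<^bsub>B\<^esub>"
        using b p B.neg_inject[of b "\<zero>\<^bsub>B\<^esub>"] by (simp add: ev)
      ultimately obtain v where v: "\<And>i. 0 \<le> v i" "\<And>i. v i \<le> 1"
        "\<And>q. q \<in> insert (Neg a) \<Phi> \<Longrightarrow> luk_val v q = 1" "luk_val v (Neg p) \<noteq> 1"
        using B.exists_separating_valuation[of "insert (Neg a) \<Phi>" s "Neg p"] assms(2) s
        by (metis finite_insert)
      obtain h where h: "mv_real_hom (LIND n \<Phi>) h"
        "\<And>p. p \<in> FORM n \<Longrightarrow> h (?c p) = luk_val v p"
        using LIND_hom[of n v \<Phi>] assms(1) v by auto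
      \<comment> \<open>Only the generator has to be checked: the kernel is an ideal and hence
        contains all of \<open>I\<close>.\<close>
      have "h (?c a) = 0" using v(3)[of "Neg a"] h(2)[OF a] by simp
      then have "I \<subseteq> {x \<in> carrier (LIND n \<Phi>). h x = 0}"
        unfolding I_gen using L.ideal_gen(3)[OF ca[OF a] L.kernel_ideal[OF h(1)]] ca[OF a] by simp
      then obtain h' where "mv_real_hom B h'"
        "\<And>x. x \<in> carrier (LIND n \<Phi>) \<Longrightarrow> h' (L.coset x I) = h x"
        using L.quotient_hom[OF h(1) I] unfolding B_def by blast
      then show ?thesis using p h(2) v(4) ca by (auto simp: d_def)
    qed
    then show ?thesis using B.semisimpleI by (simp add: B_def)
  qed
  then show ?thesis using L.mv_algebra_axioms by (simp add: mv_strongly_semisimple_def)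
qed

end
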